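(* Let $0\le n\le\infty$, let $\alpha:A\to\mathcal{T}_{\le n+1}$ be a $\mathcal{T}_{\le n+1}$-operad over $\mathbf{Set}$ and let $\varepsilon:E\to\mathcal{T}^{\times}_{\le n}$ be the corresponding $\mathcal{T}^{\times}_{\le n}$-multitensor. The following statements are equivalent: (1) $\alpha:A\to\mathcal{T}_{\le n+1}$ is contractible. (2) $\varepsilon:E\to\mathcal{T}^{\times}_{\le n}$ is contractible.
   Context: Enriched graphs. A $V$-graph $X$ consists of a set $X_0$ and objects $X(a,b)$ of $V$ for $(a,b)\in X_0\times X_0$; a morphism $f:X\to Y$ is a function $f_0:X_0\to Y_0$ with maps $f_{a,b}:X(a,b)\to Y(fa,fb)$. They form $\mathcal{G}V$. $\mathcal{G}^n\mathbf{Set}$ is the category of $n$-globular sets. For $n=\infty$ one uses the category of globular sets in place of $\mathcal{G}^n\mathbf{Set}$, identified with $\mathcal{G}$ of itself, and $\infty+1=\infty$. When $V$ has an initial object $\emptyset$, a sequence $(Z_1,\dots,Z_n)$ is regarded as the $V$-graph with objects $\{0,\dots,n\}$, hom from $i-1$ to $i$ equal to $Z_i$, other homs $\emptyset$; $0$ denotes the one-object $V$-graph with hom $\emptyset$; in $\mathbf{Set}$, $0$ denotes the one-element set. Multitensors. A multitensor $(E,u,\sigma)$ on $V$ is a functor $E:\coprod_nV^n\to V$, $E(X_1,\dots,X_n)=E_iX_i$, with natural $u_X:X\to E_1X$, $\sigma:E_iE_jX_{ij}\to E_{ij}X_{ij}$ satisfying the unit laws $\sigma\circ u_{E_iX_i}=1=\sigma\circ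 E_i(u_{X_i})$ and associativity. It is distributive when it preserves coproducts in each variable. For $V$ with coproducts and $E$ distributive, $\Gamma E$ is the monad on $\mathcal{G}V$ over $\mathbf{Set}$ (identity on object sets) with $\Gamma E(X)(a,b)=\coprod_{a=x_0,\dots,x_n=b}E_iX(x_{i-1},x_i)$, with structure induced by $u,\sigma$. For a multitensor map $\phi:E\to F$ (natural, compatible with units and substitutions), $\Gamma\phi:\Gamma E\to\Gamma F$ is identity on objects with hom maps $\coprod\phi$. For a monad $T$ on a category with finite products, $T^\times$ is the multitensor $T^\times(X_1,\dots,X_n)=\prod_iTX_i$ with unit $\eta^T$ and substitution $\prod_iT(\prod_jTX_{ij})\to\prod_i\prod_jT^2X_{ij}\to\prod_{ij}TX_{ij}$ given by the canonical comparison maps and $\mu^T$. $\mathcal{T}_{\le0}$ is the identity monad on $\mathbf{Set}$ and $\mathcal{T}_{\le n+1}=\Gamma(\mathcal{T}_{\le n}^\times)$ on $\mathcal{G}^{n+1}\mathbf{Set}$ (the strict $(n+1)$-category monad). $\mathcal{T}_{\le\infty}$ is the strict $\omega$-category monad on globular sets, with $\mathcal{T}_{\le\infty}=\Gamma(\mathcal{T}_{\le\infty}^\times)$ under the identification above. A $\mathcal{T}_{\le n+1}$-operad over $\mathbf{Set}$ is a monad $A$ on $\mathcal{G}^{n+1}\mathbf{Set}$ over $\mathbf{Set}$ with a monad morphism $\alpha:A\to\mathcal{T}_{\le n+1}$ which is cartesian (naturality squares are pullbacks) with components identities on objects. A $\mathcal{T}_{\le n}^\times$-multitensor is a multitensor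 $E$ on $\mathcal{G}^n\mathbf{Set}$ with a cartesian natural multitensor map $\varepsilon:E\to\mathcal{T}_{\le n}^\times$. The assignment $\varepsilon\mapsto\Gamma\varepsilon$ is an equivalence between the categories of $\mathcal{T}_{\le n}^\times$-multitensors and of $\mathcal{T}_{\le n+1}$-operads over $\mathbf{Set}$; $\varepsilon$ corresponds to $\alpha$ when $\Gamma\varepsilon\cong\alpha$ over $\mathcal{T}_{\le n+1}$. Trivial fibrations. For a class $\mathcal{I}$ of maps in $V$, a trivial $\mathcal{I}$-fibration is a map with the right lifting property with respect to all maps of $\mathcal{I}$; a natural transformation into $V$ is a trivial $\mathcal{I}$-fibration when all its components are. $\mathcal{I}^+$ is the class of maps of $\mathcal{G}V$ consisting of $\emptyset\to0$ and $(i):(S)\to(B)$ for $i:S\to B$ in $\mathcal{I}$. $\mathcal{I}_{\le0}$ consists of the functions $\emptyset\to0$ and $0+0\to0$ in $\mathbf{Set}$; $\mathcal{I}_{\le n+1}=(\mathcal{I}_{\le n})^+$, in $\mathcal{G}^{n+1}\mathbf{Set}$. In globular sets, $\mathcal{I}_{\le\infty}$ consists of all the boundary inclusions $\partial k\hookrightarrow k$ ($k\in\mathbb{N}$), where $k$ is the representable $k$-globe and $\partial k$ is it with its unique $k$-cell removed; $\mathcal{I}_{\le\infty}=\mathcal{I}_{\le\infty}^+$. An operad $\alpha:A\to\mathcal{T}_{\le n}$ is contractible when $\alpha$ is a trivial $\mathcal{I}_{\le n}$-fibration; a multitensor $\varepsilon:E\to\mathcal{T}_{\le n}^\times$ is contractible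 when $\varepsilon$ is a trivial $\mathcal{I}_{\le n}$-fibration. *)

theory Defs
  imports "HOL-Library.FuncSet" "HOL-Library.Extended_Nat"
begin

section \<open>Categories, monads, multitensors\<close>

record ('o, 'm) category =
  Obj :: "'o set"
  Arr :: "'m set"
  Dom :: "'m \<Rightarrow> 'o"
  Cod :: "'m \<Rightarrow> 'o"
  Id :: "'o \<Rightarrow> 'm"
  Cmp :: "'m \<Rightarrow> 'm \<Rightarrow> 'm"  (infixl "\<cdot>\<index>" 70)

text \<open>Chosen finite products of lists of objects, and chosen coproducts of families of objects
  indexed by sets of elements of \<open>'i\<close>.\<close>

record ('o, 'm, 'i) pc_category = "('o, 'm) category" +
  Prd :: "'o list \<Rightarrow> 'o"
  Prj :: "'o list \<Rightarrow> nat \<Rightarrow> 'm"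
  Cop :: "'i set \<Rightarrow> ('i \<Rightarrow> 'o) \<Rightarrow> 'o"
  Inj :: "'i set \<Rightarrow> ('i \<Rightarrow> 'o) \<Rightarrow> 'i \<Rightarrow> 'm"

definition Hom :: "('o, 'm, 'z) category_scheme \<Rightarrow> 'o \<Rightarrow> 'o \<Rightarrow> 'm set" where
  "Hom C X Y = {f \<in> Arr C. Dom C f = X \<and> Cod C f = Y}"

definition is_iso :: "('o, 'm, 'z) category_scheme \<Rightarrow> 'm \<Rightarrow> bool" where
  "is_iso C f \<longleftrightarrow> f \<in> Arr C \<and>
     (\<exists>g\<in>Hom C (Cod C f) (Dom C f). g \<cdot>\<^bsub>C\<^esub> f = Id C (Dom C f) \<and> f \<cdot>\<^bsub>C\<^esub> g = Id C (Cod C f))"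

definition is_pullback :: "('o, 'm, 'z) category_scheme \<Rightarrow> 'm \<Rightarrow> 'm \<Rightarrow> 'm \<Rightarrow> 'm \<Rightarrow> bool" where
  "is_pullback C p q f g \<longleftrightarrow>
     p \<in> Hom C (Dom C p) (Dom C f) \<and> q \<in> Hom C (Dom C p) (Dom C g) \<and>
     f \<in> Hom C (Dom C f) (Cod C f) \<and> g \<in> Hom C (Dom C g) (Cod C f) \<and>
     f \<cdot>\<^bsub>C\<^esub> p = g \<cdot>\<^bsub>C\<^esub> q \<and>
     (\<forall>W\<in>Obj C. \<forall>h\<in>Hom C W (Dom C f). \<forall>k\<in>Hom C W (Dom C g). f \<cdot>\<^bsub>C\<^esub> h = g \<cdot>\<^bsub>C\<^esub> k \<longrightarrow>
        (\<exists>!r. r \<in> Hom C W (Dom C p) \<and> p \<cdot>\<^bsub>C\<^esub> r = h \<and> q \<cdot>\<^bsub>C\<^esub> r = k))"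

text \<open>The morphisms given by the universal properties of the chosen products and coproducts.\<close>

definition tuple :: "('o, 'm, 'i, 'z) pc_category_scheme \<Rightarrow> 'o \<Rightarrow> 'o list \<Rightarrow> 'm list \<Rightarrow> 'm" where
  "tuple C W Xs fs = (THE h. h \<in> Hom C W (Prd C Xs) \<and> (\<forall>i<length Xs. Prj C Xs i \<cdot>\<^bsub>C\<^esub> h = fs ! i))"

definition cotuple ::
    "('o, 'm, 'i, 'z) pc_category_scheme \<Rightarrow> 'i set \<Rightarrow> ('i \<Rightarrow> 'o) \<Rightarrow> 'o \<Rightarrow> ('i \<Rightarrow> 'm) \<Rightarrow> 'm" where
  "cotuple C I F Z g = (THE h. h \<in> Hom C (Cop C I F) Z \<and> (\<forall>i\<in>I. h \<cdot>\<^bsub>C\<^esub> Inj C I F i = g i))"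

definition has_rlp :: "('o, 'm, 'z) category_scheme \<Rightarrow> 'm \<Rightarrow> 'm \<Rightarrow> bool" where
  "has_rlp C f i \<longleftrightarrow>
     (\<forall>u\<in>Hom C (Dom C i) (Dom C f). \<forall>v\<in>Hom C (Cod C i) (Cod C f). f \<cdot>\<^bsub>C\<^esub> u = v \<cdot>\<^bsub>C\<^esub> i \<longrightarrow>
        (\<exists>d\<in>Hom C (Cod C i) (Dom C f). d \<cdot>\<^bsub>C\<^esub> i = u \<and> f \<cdot>\<^bsub>C\<^esub> d = v))"

definition trivial_fibration :: "('o, 'm, 'z) category_scheme \<Rightarrow> 'm set \<Rightarrow> 'm \<Rightarrow> bool" where
  "trivial_fibration C \<I> f \<longleftrightarrow> f \<in> Arr C \<and> (\<forall>i\<in>\<I>. has_rlp C f i)"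

record ('o, 'm) monad =
  Fo :: "'o \<Rightarrow> 'o"
  Fa :: "'m \<Rightarrow> 'm"
  Eta :: "'o \<Rightarrow> 'm"
  Mu :: "'o \<Rightarrow> 'm"

definition is_monad :: "('o, 'm, 'z) category_scheme \<Rightarrow> ('o, 'm) monad \<Rightarrow> bool" where
  "is_monad C T \<longleftrightarrow>
     (\<forall>X\<in>Obj C. Fo T X \<in> Obj C) \<and>
     (\<forall>f\<in>Arr C. Fa T f \<in> Hom C (Fo T (Dom C f)) (Fo T (Cod C f))) \<and>
     (\<forall>X\<in>Obj C. Fa T (Id C X) = Id C (Fo T X)) \<and>
     (\<forall>f\<in>Arr C. \<forall>g\<in>Arr C. Cod C f = Dom C g \<longrightarrow> Fa T (g \<cdot>\<^bsub>C\<^esub> f) = Fa T g \<cdot>\<^bsub>C\<^esub> Fa T f) \<and>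
     (\<forall>X\<in>Obj C. Eta T X \<in> Hom C X (Fo T X)) \<and>
     (\<forall>f\<in>Arr C. Fa T f \<cdot>\<^bsub>C\<^esub> Eta T (Dom C f) = Eta T (Cod C f) \<cdot>\<^bsub>C\<^esub> f) \<and>
     (\<forall>X\<in>Obj C. Mu T X \<in> Hom C (Fo T (Fo T X)) (Fo T X)) \<and>
     (\<forall>f\<in>Arr C. Fa T f \<cdot>\<^bsub>C\<^esub> Mu T (Dom C f) = Mu T (Cod C f) \<cdot>\<^bsub>C\<^esub> Fa T (Fa T f)) \<and>
     (\<forall>X\<in>Obj C. Mu T X \<cdot>\<^bsub>C\<^esub> Eta T (Fo T X) = Id C (Fo T X) \<and>
                Mu T X \<cdot>\<^bsub>C\<^esub> Fa T (Eta T X) = Id C (Fo T X) \<and>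
                Mu T X \<cdot>\<^bsub>C\<^esub> Mu T (Fo T X) = Mu T X \<cdot>\<^bsub>C\<^esub> Fa T (Mu T X))"

definition is_monad_map ::
    "('o, 'm, 'z) category_scheme \<Rightarrow> ('o, 'm) monad \<Rightarrow> ('o, 'm) monad \<Rightarrow> ('o \<Rightarrow> 'm) \<Rightarrow> bool" where
  "is_monad_map C S T \<phi> \<longleftrightarrow>
     (\<forall>X\<in>Obj C. \<phi> X \<in> Hom C (Fo S X) (Fo T X)) \<and>
     (\<forall>f\<in>Arr C. Fa T f \<cdot>\<^bsub>C\<^esub> \<phi> (Dom C f) = \<phi> (Cod C f) \<cdot>\<^bsub>C\<^esub> Fa S f) \<and>
     (\<forall>X\<in>Obj C. \<phi> X \<cdot>\<^bsub>C\<^esub> Eta S X = Eta T X) \<and>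
     (\<forall>X\<in>Obj C. \<phi> X \<cdot>\<^bsub>C\<^esub> Mu S X = Mu T X \<cdot>\<^bsub>C\<^esub> (Fa T (\<phi> X) \<cdot>\<^bsub>C\<^esub> \<phi> (Fo S X)))"

definition is_cartesian ::
    "('o, 'm, 'z) category_scheme \<Rightarrow> ('o, 'm) monad \<Rightarrow> ('o, 'm) monad \<Rightarrow> ('o \<Rightarrow> 'm) \<Rightarrow> bool" where
  "is_cartesian C S T \<phi> \<longleftrightarrow>
     (\<forall>f\<in>Arr C. is_pullback C (\<phi> (Dom C f)) (Fa S f) (Fa T f) (\<phi> (Cod C f)))"

text \<open>\<open>Mo E [X\<^sub>1,\<dots>,X\<^sub>n]\<close> is \<open>E(X\<^sub>1,\<dots>,X\<^sub>n)\<close> and \<open>Ms E [[X\<^sub>1\<^sub>1,\<dots>],\<dots>]\<close> is the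
  substitution \<open>\<sigma> : E\<^sub>i E\<^sub>j X\<^sub>i\<^sub>j \<rightarrow> E\<^sub>i\<^sub>j X\<^sub>i\<^sub>j\<close>.\<close>

record ('o, 'm) multitensor =
  Mo :: "'o list \<Rightarrow> 'o"
  Ma :: "'m list \<Rightarrow> 'm"
  Mn :: "'o \<Rightarrow> 'm"
  Ms :: "'o list list \<Rightarrow> 'm"

definition is_multitensor :: "('o, 'm, 'z) category_scheme \<Rightarrow> ('o, 'm) multitensor \<Rightarrow> bool" where
  "is_multitensor C E \<longleftrightarrow>
     (\<forall>Xs\<in>lists (Obj C). Mo E Xs \<in> Obj C) \<and>
     (\<forall>fs\<in>lists (Arr C). Ma E fs \<in> Hom C (Mo E (map (Dom C) fs)) (Mo E (map (Cod C) fs))) \<and>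
     (\<forall>Xs\<in>lists (Obj C). Ma E (map (Id C) Xs) = Id C (Mo E Xs)) \<and>
     (\<forall>fs\<in>lists (Arr C). \<forall>gs\<in>lists (Arr C). map (Cod C) fs = map (Dom C) gs \<longrightarrow>
        Ma E (map2 (Cmp C) gs fs) = Ma E gs \<cdot>\<^bsub>C\<^esub> Ma E fs) \<and>
     (\<forall>X\<in>Obj C. Mn E X \<in> Hom C X (Mo E [X])) \<and>
     (\<forall>f\<in>Arr C. Ma E [f] \<cdot>\<^bsub>C\<^esub> Mn E (Dom C f) = Mn E (Cod C f) \<cdot>\<^bsub>C\<^esub> f) \<and>
     (\<forall>Xss\<in>lists (lists (Obj C)). Ms E Xss \<in> Hom C (Mo E (map (Mo E) Xss)) (Mo E (concat Xss))) \<and>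
     (\<forall>fss\<in>lists (lists (Arr C)).
        Ma E (concat fss) \<cdot>\<^bsub>C\<^esub> Ms E (map (map (Dom C)) fss) =
        Ms E (map (map (Cod C)) fss) \<cdot>\<^bsub>C\<^esub> Ma E (map (Ma E) fss)) \<and>
     (\<forall>Xs\<in>lists (Obj C).
        Ms E [Xs] \<cdot>\<^bsub>C\<^esub> Mn E (Mo E Xs) = Id C (Mo E Xs) \<and>
        Ms E (map (\<lambda>X. [X]) Xs) \<cdot>\<^bsub>C\<^esub> Ma E (map (Mn E) Xs) = Id C (Mo E Xs)) \<and>
     (\<forall>Xsss\<in>lists (lists (lists (Obj C))).
        Ms E (map concat Xsss) \<cdot>\<^bsub>C\<^esub> Ma E (map (Ms E) Xsss) =
        Ms E (concat Xsss) \<cdot>\<^bsub>C\<^esub> Ms E (map (map (Mo E)) Xsss))"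

definition is_multitensor_map ::
    "('o, 'm, 'z) category_scheme \<Rightarrow> ('o, 'm) multitensor \<Rightarrow> ('o, 'm) multitensor \<Rightarrow>
     ('o list \<Rightarrow> 'm) \<Rightarrow> bool" where
  "is_multitensor_map C E F \<phi> \<longleftrightarrow>
     (\<forall>Xs\<in>lists (Obj C). \<phi> Xs \<in> Hom C (Mo E Xs) (Mo F Xs)) \<and>
     (\<forall>fs\<in>lists (Arr C).
        Ma F fs \<cdot>\<^bsub>C\<^esub> \<phi> (map (Dom C) fs) = \<phi> (map (Cod C) fs) \<cdot>\<^bsub>C\<^esub> Ma E fs) \<and>
     (\<forall>X\<in>Obj C. \<phi> [X] \<cdot>\<^bsub>C\<^esub> Mn E X = Mn F X) \<and>
     (\<forall>Xss\<in>lists (lists (Obj C)).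
        \<phi> (concat Xss) \<cdot>\<^bsub>C\<^esub> Ms E Xss =
        Ms F Xss \<cdot>\<^bsub>C\<^esub> (\<phi> (map (Mo F) Xss) \<cdot>\<^bsub>C\<^esub> Ma E (map \<phi> Xss)))"

definition is_cartesian_multi ::
    "('o, 'm, 'z) category_scheme \<Rightarrow> ('o, 'm) multitensor \<Rightarrow> ('o, 'm) multitensor \<Rightarrow>
     ('o list \<Rightarrow> 'm) \<Rightarrow> bool" where
  "is_cartesian_multi C E F \<phi> \<longleftrightarrow>
     (\<forall>fs\<in>lists (Arr C).
        is_pullback C (\<phi> (map (Dom C) fs)) (Ma E fs) (Ma F fs) (\<phi> (map (Cod C) fs)))"

text \<open>The multitensor \<open>T\<^sup>\<times>\<close>. The factor \<open>(i,j)\<close> of the substitution is the composite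
  \<open>\<Prod>\<^sub>i T(\<Prod>\<^sub>j T X\<^sub>i\<^sub>j) \<rightarrow> T(\<Prod>\<^sub>j T X\<^sub>i\<^sub>j) \<rightarrow> T T X\<^sub>i\<^sub>j \<rightarrow> T X\<^sub>i\<^sub>j\<close> of
  a projection, the image under \<open>T\<close> of a projection, and the multiplication.\<close>

definition cross ::
    "('o, 'm, 'i, 'z) pc_category_scheme \<Rightarrow> ('o, 'm) monad \<Rightarrow> ('o, 'm) multitensor" where
  "cross C T =
     (let P = (\<lambda>Xs. Prd C (map (Fo T) Xs)) in
      \<lparr> Mo = P,
        Ma = (\<lambda>fs. let Xs = map (Fo T) (map (Dom C) fs) in
                tuple C (Prd C Xs) (map (Fo T) (map (Cod C) fs))
                  (map (\<lambda>i. Fa T (fs ! i) \<cdot>\<^bsub>C\<^esub> Prj C Xs i) [0..<length fs])),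
        Mn = (\<lambda>X. tuple C X [Fo T X] [Eta T X]),
        Ms = (\<lambda>Xss. let Ys = map (\<lambda>Xs. Fo T (P Xs)) Xss in
                tuple C (Prd C Ys) (map (Fo T) (concat Xss))
                  (concat (map (\<lambda>i. map (\<lambda>j.
                      Mu T (Xss ! i ! j) \<cdot>\<^bsub>C\<^esub> (Fa T (Prj C (map (Fo T) (Xss ! i)) j) \<cdot>\<^bsub>C\<^esub> Prj C Ys i))
                    [0..<length (Xss ! i)]) [0..<length Xss]))) \<rparr>)"


section \<open>Enriched graphs and globular sets\<close>

text \<open>A globular set consists of a set of 0-cells and, for each pair of 0-cells, a globular set
  of higher cells between them. All the categories \<open>\<G>\<^sup>nSet\<close> live on this one type, so that \<open>\<G>\<close>
  can be iterated; \<open>n\<close>-globular sets have the empty globular set \<open>void\<close> in all positions beyond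
  dimension \<open>n\<close>, and so do all positions that are not indexed by 0-cells.\<close>

codatatype 'u gset = Gset (ob: "'u set") (hm: "'u \<Rightarrow> 'u \<Rightarrow> 'u gset")

primcorec void :: "'u gset" where
  "ob void = {}"
| "hm void = (\<lambda>_ _. void)"

codatatype 'u gmap =
  Gmap (dm: "'u gset") (cd: "'u gset") (obm: "'u \<Rightarrow> 'u") (hmm: "'u \<Rightarrow> 'u \<Rightarrow> 'u gmap")

primcorec void_map :: "'u gmap" where
  "dm void_map = void"
| "cd void_map = void"
| "obm void_map = (\<lambda>_. undefined)"
| "hmm void_map = (\<lambda>_ _. void_map)"

text \<open>Which subsets of the universe \<open>'u\<close> count as small sets. Both the predicate true of every
  subset of an infinite type, and smallness in a type of ZF sets and classes, are instances.
  The closure conditions provide the finite limits and the small coproducts that are used; closure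
  under power sets is not needed.\<close>

definition universe :: "('u set \<Rightarrow> bool) \<Rightarrow> bool" where
  "universe U \<longleftrightarrow> (\<exists>A. U A \<and> infinite A) \<and>
     (\<forall>A B f. U A \<and> B \<subseteq> f ` A \<longrightarrow> U B) \<and>
     (\<forall>A F. U A \<and> (\<forall>a\<in>A. U (F a)) \<longrightarrow> U (\<Union>a\<in>A. F a))"

text \<open>Codes for finite sequences; \<open>tup\<close> is injective as soon as \<open>'u\<close> is infinite.\<close>

definition tup :: "'u list \<Rightarrow> 'u" where
  "tup = (SOME f. inj f)"

definition untup :: "'u \<Rightarrow> 'u list" where
  "untup = inv tup"

definition num :: "nat \<Rightarrow> 'u" where
  "num k = tup (replicate k (tup []))"

definition tuples :: "'u set list \<Rightarrow> 'u set" where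
  "tuples As = tup ` listset As"

definition tag :: "'u list \<Rightarrow> 'u \<Rightarrow> 'u" where
  "tag i x = tup [tup i, x]"

definition tag_index :: "'u \<Rightarrow> 'u list" where
  "tag_index c = untup (untup c ! 0)"

definition tag_elem :: "'u \<Rightarrow> 'u" where
  "tag_elem c = untup c ! 1"

definition tagged :: "'u list set \<Rightarrow> ('u list \<Rightarrow> 'u set) \<Rightarrow> 'u set" where
  "tagged I A = (\<Union>i\<in>I. tag i ` A i)"

type_synonym 'u gcat = "('u gset, 'u gmap, 'u list) pc_category"

definition Sets :: "('u set \<Rightarrow> bool) \<Rightarrow> 'u gcat" where
  "Sets U =
     (let discrete = (\<lambda>A. Gset A (\<lambda>_ _. void));
          func = (\<lambda>X Y f. Gmap X Y (restrict f (ob X)) (\<lambda>_ _. void_map));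
          Ob = {X. U (ob X) \<and> hm X = (\<lambda>_ _. void)};
          P = (\<lambda>Xs. discrete (tuples (map ob Xs)));
          Q = (\<lambda>I F. discrete (tagged I (\<lambda>i. ob (F i)))) in
      \<lparr> Obj = Ob,
        Arr = {f. dm f \<in> Ob \<and> cd f \<in> Ob \<and> obm f \<in> ob (dm f) \<rightarrow>\<^sub>E ob (cd f) \<and>
                  hmm f = (\<lambda>_ _. void_map)},
        Dom = dm,
        Cod = cd,
        Id = (\<lambda>X. func X X (\<lambda>x. x)),
        Cmp = (\<lambda>g f. func (dm f) (cd g) (\<lambda>x. obm g (obm f x))),
        Prd = P,
        Prj = (\<lambda>Xs i. if i < length Xs then func (P Xs) (Xs ! i) (\<lambda>c. untup c ! i) else void_map),
        Cop = Q,
        Inj = (\<lambda>I F i. func (F i) (Q I F) (tag i)) \<rparr>)"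

text \<open>A graph on a set of objects \<open>A\<close>, and a morphism of graphs.\<close>

definition mk_graph :: "'u set \<Rightarrow> ('u \<Rightarrow> 'u \<Rightarrow> 'u gset) \<Rightarrow> 'u gset" where
  "mk_graph A H = Gset A (\<lambda>a b. if a \<in> A \<and> b \<in> A then H a b else void)"

definition mk_map ::
    "'u gset \<Rightarrow> 'u gset \<Rightarrow> ('u \<Rightarrow> 'u) \<Rightarrow> ('u \<Rightarrow> 'u \<Rightarrow> 'u gmap) \<Rightarrow> 'u gmap" where
  "mk_map X Y f h = Gmap X Y (restrict f (ob X))
     (\<lambda>a b. if a \<in> ob X \<and> b \<in> ob X then h a b else void_map)"

definition components :: "'u gset list \<Rightarrow> 'u \<Rightarrow> 'u \<Rightarrow> 'u gset list" where
  "components Xs c d = map (\<lambda>i. hm (Xs ! i) (untup c ! i) (untup d ! i)) [0..<length Xs]"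

text \<open>The category \<open>\<G>V\<close> of \<open>V\<close>-graphs, for \<open>V\<close> with initial object \<open>void\<close>. In a coproduct of
  graphs the homs between objects of different summands are initial.\<close>

definition Graphs :: "('u set \<Rightarrow> bool) \<Rightarrow> 'u gcat \<Rightarrow> 'u gcat" where
  "Graphs U V =
     (let Ob = {X. U (ob X) \<and> (\<forall>a b. if a \<in> ob X \<and> b \<in> ob X then hm X a b \<in> Obj V else hm X a b = void)};
          P = (\<lambda>Xs. mk_graph (tuples (map ob Xs)) (\<lambda>c d. Prd V (components Xs c d)));
          Q = (\<lambda>I F. mk_graph (tagged I (\<lambda>i. ob (F i)))
                 (\<lambda>c d. if tag_index c = tag_index d
                        then hm (F (tag_index c)) (tag_elem c) (tag_elem d) else void)) in
      \<lparr> Obj = Ob,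
        Arr = {f. dm f \<in> Ob \<and> cd f \<in> Ob \<and> obm f \<in> ob (dm f) \<rightarrow>\<^sub>E ob (cd f) \<and>
                  (\<forall>a b. if a \<in> ob (dm f) \<and> b \<in> ob (dm f)
                         then hmm f a b \<in> Hom V (hm (dm f) a b) (hm (cd f) (obm f a) (obm f b))
                         else hmm f a b = void_map)},
        Dom = dm,
        Cod = cd,
        Id = (\<lambda>X. mk_map X X (\<lambda>x. x) (\<lambda>a b. Id V (hm X a b))),
        Cmp = (\<lambda>g f. mk_map (dm f) (cd g) (\<lambda>x. obm g (obm f x))
                 (\<lambda>a b. hmm g (obm f a) (obm f b) \<cdot>\<^bsub>V\<^esub> hmm f a b)),
        Prd = P,
        Prj = (\<lambda>Xs i. if i < length Xs
                 then mk_map (P Xs) (Xs ! i) (\<lambda>c. untup c ! i) (\<lambda>c d. Prj V (components Xs c d) i)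
                 else void_map),
        Cop = Q,
        Inj = (\<lambda>I F i. mk_map (F i) (Q I F) (tag i) (\<lambda>a b. Id V (hm (F i) a b))) \<rparr>)"

primrec Glob_fin :: "('u set \<Rightarrow> bool) \<Rightarrow> nat \<Rightarrow> 'u gcat" where
  "Glob_fin U 0 = Sets U"
| "Glob_fin U (Suc n) = Graphs U (Glob_fin U n)"

text \<open>Truncation at dimension \<open>n\<close>, and the globular set (morphism) whose \<open>n\<close>-truncation is the
  \<open>n\<close>-th term of a coherent sequence.\<close>

primrec trunc :: "nat \<Rightarrow> 'u gset \<Rightarrow> 'u gset" where
  "trunc 0 X = Gset (ob X) (\<lambda>_ _. void)"
| "trunc (Suc n) X = Gset (ob X) (\<lambda>a b. trunc n (hm X a b))"

primrec trunc_map :: "nat \<Rightarrow> 'u gmap \<Rightarrow> 'u gmap" where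
  "trunc_map 0 f = Gmap (trunc 0 (dm f)) (trunc 0 (cd f)) (obm f) (\<lambda>_ _. void_map)"
| "trunc_map (Suc n) f =
     Gmap (trunc (Suc n) (dm f)) (trunc (Suc n) (cd f)) (obm f) (\<lambda>a b. trunc_map n (hmm f a b))"

primcorec glue :: "(nat \<Rightarrow> 'u gset) \<Rightarrow> 'u gset" where
  "ob (glue X) = ob (X 0)"
| "hm (glue X) = (\<lambda>a b. glue (\<lambda>n. hm (X (Suc n)) a b))"

primcorec glue_map :: "(nat \<Rightarrow> 'u gmap) \<Rightarrow> 'u gmap" where
  "dm (glue_map f) = glue (\<lambda>n. dm (f n))"
| "cd (glue_map f) = glue (\<lambda>n. cd (f n))"
| "obm (glue_map f) = obm (f 0)"
| "hmm (glue_map f) = (\<lambda>a b. glue_map (\<lambda>n. hmm (f (Suc n)) a b))"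

text \<open>Globular sets: the limit of the categories of \<open>n\<close>-globular sets along truncation, with all
  structure computed dimensionwise. By \<open>Glob_Suc\<close> below this category is equal to \<open>\<G>\<close> of
  itself.\<close>

definition Glob_lim :: "('u set \<Rightarrow> bool) \<Rightarrow> 'u gcat" where
  "Glob_lim U =
     \<lparr> Obj = {X. \<forall>n. trunc n X \<in> Obj (Glob_fin U n)},
       Arr = {f. \<forall>n. trunc_map n f \<in> Arr (Glob_fin U n)},
       Dom = dm,
       Cod = cd,
       Id = (\<lambda>X. glue_map (\<lambda>n. Id (Glob_fin U n) (trunc n X))),
       Cmp = (\<lambda>g f. glue_map (\<lambda>n. Cmp (Glob_fin U n) (trunc_map n g) (trunc_map n f))),
       Prd = (\<lambda>Xs. glue (\<lambda>n. Prd (Glob_fin U n) (map (trunc n) Xs))),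
       Prj = (\<lambda>Xs i. glue_map (\<lambda>n. Prj (Glob_fin U n) (map (trunc n) Xs) i)),
       Cop = (\<lambda>I F. glue (\<lambda>n. Cop (Glob_fin U n) I (\<lambda>i. trunc n (F i)))),
       Inj = (\<lambda>I F i. glue_map (\<lambda>n. Inj (Glob_fin U n) I (\<lambda>i. trunc n (F i)) i)) \<rparr>"

definition Glob :: "('u set \<Rightarrow> bool) \<Rightarrow> enat \<Rightarrow> 'u gcat" where
  "Glob U n = (case n of enat k \<Rightarrow> Glob_fin U k | \<infinity> \<Rightarrow> Glob_lim U)"


section \<open>The monad of a distributive multitensor\<close>

text \<open>Paths \<open>a = x\<^sub>0, \<dots>, x\<^sub>n = b\<close> are the nonempty lists \<open>[x\<^sub>0, \<dots>, x\<^sub>n]\<close>.\<close>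

definition paths :: "'u gset \<Rightarrow> 'u \<Rightarrow> 'u \<Rightarrow> 'u list set" where
  "paths X a b = {p. p \<noteq> [] \<and> set p \<subseteq> ob X \<and> hd p = a \<and> last p = b}"

definition steps :: "'u list \<Rightarrow> ('u \<times> 'u) list" where
  "steps p = zip p (tl p)"

definition homs :: "'u gset \<Rightarrow> 'u list \<Rightarrow> 'u gset list" where
  "homs X p = map (\<lambda>(a, b). hm X a b) (steps p)"

definition hom_maps :: "'u gmap \<Rightarrow> 'u list \<Rightarrow> 'u gmap list" where
  "hom_maps f p = map (\<lambda>(a, b). hmm f a b) (steps p)"

text \<open>\<open>refinements X p\<close> are the lists of paths, one for each step of \<open>p\<close>; they are joined to a
  single path.\<close>

definition refinements :: "'u gset \<Rightarrow> 'u list \<Rightarrow> 'u list list set" where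
  "refinements X p = listset (map (\<lambda>(a, b). paths X a b) (steps p))"

definition join :: "'u list \<Rightarrow> 'u list list \<Rightarrow> 'u list" where
  "join p qs = hd p # concat (map tl qs)"

type_synonym 'u gmonad = "('u gset, 'u gmap) monad"
type_synonym 'u gtensor = "('u gset, 'u gmap) multitensor"

definition Gamma_obj :: "'u gcat \<Rightarrow> 'u gtensor \<Rightarrow> 'u gset \<Rightarrow> 'u gset" where
  "Gamma_obj V E X = mk_graph (ob X) (\<lambda>a b. Cop V (paths X a b) (\<lambda>p. Mo E (homs X p)))"

text \<open>The inclusion of the summand of a path \<open>p\<close>, with domain \<open>Mo E (homs X p)\<close>.\<close>

definition summand :: "'u gcat \<Rightarrow> 'u gtensor \<Rightarrow> 'u gset \<Rightarrow> 'u list \<Rightarrow> 'u gmap" where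
  "summand V E X p = Inj V (paths X (hd p) (last p)) (\<lambda>p. Mo E (homs X p)) p"

definition from_sum ::
    "'u gcat \<Rightarrow> 'u gtensor \<Rightarrow> 'u gset \<Rightarrow> 'u \<Rightarrow> 'u \<Rightarrow> 'u gset \<Rightarrow> ('u list \<Rightarrow> 'u gmap) \<Rightarrow> 'u gmap" where
  "from_sum V E X a b Z g = cotuple V (paths X a b) (\<lambda>p. Mo E (homs X p)) Z g"

text \<open>As \<open>E\<close> is distributive, a map out of \<open>\<Coprod>\<^sub>p E\<^sub>i (\<Coprod>\<^sub>q E\<^sub>j X(q\<^sub>j\<^sub>-\<^sub>1, q\<^sub>j))\<close> is determined by its
  restrictions to all \<open>E\<^sub>i E\<^sub>j X(q\<^sub>i\<^sub>,\<^sub>j\<^sub>-\<^sub>1, q\<^sub>i\<^sub>,\<^sub>j)\<close>; for the multiplication these are the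
  substitutions of \<open>E\<close>, followed by the inclusion of the summand of the joined path.\<close>

definition Gamma :: "'u gcat \<Rightarrow> 'u gtensor \<Rightarrow> 'u gmonad" where
  "Gamma V E =
     (let G = Gamma_obj V E in
      \<lparr> Fo = G,
        Fa = (\<lambda>f. mk_map (G (dm f)) (G (cd f)) (obm f) (\<lambda>a b.
                from_sum V E (dm f) a b (hm (G (cd f)) (obm f a) (obm f b))
                  (\<lambda>p. summand V E (cd f) (map (obm f) p) \<cdot>\<^bsub>V\<^esub> Ma E (hom_maps f p)))),
        Eta = (\<lambda>X. mk_map X (G X) (\<lambda>x. x) (\<lambda>a b. summand V E X [a, b] \<cdot>\<^bsub>V\<^esub> Mn E (hm X a b))),
        Mu = (\<lambda>X. mk_map (G (G X)) (G X) (\<lambda>x. x) (\<lambda>a b.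
                THE m. m \<in> Hom V (hm (G (G X)) a b) (hm (G X) a b) \<and>
                  (\<forall>p\<in>paths X a b. \<forall>qs\<in>refinements X p.
                     m \<cdot>\<^bsub>V\<^esub> (summand V E (G X) p \<cdot>\<^bsub>V\<^esub> Ma E (map (summand V E X) qs)) =
                     summand V E X (join p qs) \<cdot>\<^bsub>V\<^esub> Ms E (map (homs X) qs)))) \<rparr>)"

definition Gamma_map ::
    "'u gcat \<Rightarrow> 'u gtensor \<Rightarrow> 'u gtensor \<Rightarrow> ('u gset list \<Rightarrow> 'u gmap) \<Rightarrow> 'u gset \<Rightarrow> 'u gmap" where
  "Gamma_map V E F \<phi> X =
     mk_map (Gamma_obj V E X) (Gamma_obj V F X) (\<lambda>x. x) (\<lambda>a b.
       from_sum V E X a b (hm (Gamma_obj V F X) a b)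
         (\<lambda>p. summand V F X p \<cdot>\<^bsub>V\<^esub> \<phi> (homs X p)))"


section \<open>Strict higher categories, operads, contractibility\<close>

definition id_monad :: "('o, 'm, 'z) category_scheme \<Rightarrow> ('o, 'm) monad" where
  "id_monad C = \<lparr> Fo = (\<lambda>X. X), Fa = (\<lambda>f. f), Eta = Id C, Mu = Id C \<rparr>"

primrec strict_fin :: "('u set \<Rightarrow> bool) \<Rightarrow> nat \<Rightarrow> 'u gmonad" where
  "strict_fin U 0 = id_monad (Sets U)"
| "strict_fin U (Suc n) = Gamma (Glob_fin U n) (cross (Glob_fin U n) (strict_fin U n))"

text \<open>The \<open>n\<close>-truncation of the free strict \<open>\<omega>\<close>-category on a globular set is the free strict
  \<open>n\<close>-category on its \<open>n\<close>-truncation. This determines \<open>T\<^sub>\<le>\<^sub>\<infinity>\<close> as the solution of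
  \<open>T\<^sub>\<le>\<^sub>\<infinity> = \<Gamma>(T\<^sub>\<le>\<^sub>\<infinity>\<^sup>\<times>)\<close>; see \<open>strict_Suc\<close> below.\<close>

definition strict_lim :: "('u set \<Rightarrow> bool) \<Rightarrow> 'u gmonad" where
  "strict_lim U =
     \<lparr> Fo = (\<lambda>X. glue (\<lambda>n. Fo (strict_fin U n) (trunc n X))),
       Fa = (\<lambda>f. glue_map (\<lambda>n. Fa (strict_fin U n) (trunc_map n f))),
       Eta = (\<lambda>X. glue_map (\<lambda>n. Eta (strict_fin U n) (trunc n X))),
       Mu = (\<lambda>X. glue_map (\<lambda>n. Mu (strict_fin U n) (trunc n X))) \<rparr>"

definition strict :: "('u set \<Rightarrow> bool) \<Rightarrow> enat \<Rightarrow> 'u gmonad" where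
  "strict U n = (case n of enat k \<Rightarrow> strict_fin U k | \<infinity> \<Rightarrow> strict_lim U)"

definition identity_on_objects :: "'u gmap \<Rightarrow> bool" where
  "identity_on_objects f \<longleftrightarrow> ob (cd f) = ob (dm f) \<and> (\<forall>x\<in>ob (dm f). obm f x = x)"

definition is_monad_over_Set :: "'u gcat \<Rightarrow> 'u gmonad \<Rightarrow> bool" where
  "is_monad_over_Set C A \<longleftrightarrow> is_monad C A \<and>
     (\<forall>X\<in>Obj C. ob (Fo A X) = ob X) \<and>
     (\<forall>f\<in>Arr C. \<forall>x\<in>ob (dm f). obm (Fa A f) x = obm f x) \<and>
     (\<forall>X\<in>Obj C. identity_on_objects (Eta A X) \<and> identity_on_objects (Mu A X))"

text \<open>\<open>T\<^sub>\<le>\<^sub>n\<close>-operads over Set, for \<open>n > 0\<close>.\<close>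

definition is_operad_over_Set ::
    "('u set \<Rightarrow> bool) \<Rightarrow> enat \<Rightarrow> 'u gmonad \<Rightarrow> ('u gset \<Rightarrow> 'u gmap) \<Rightarrow> bool" where
  "is_operad_over_Set U n A \<alpha> \<longleftrightarrow>
     is_monad_over_Set (Glob U n) A \<and>
     is_monad_map (Glob U n) A (strict U n) \<alpha> \<and>
     is_cartesian (Glob U n) A (strict U n) \<alpha> \<and>
     (\<forall>X\<in>Obj (Glob U n). identity_on_objects (\<alpha> X))"

definition strict_cross :: "('u set \<Rightarrow> bool) \<Rightarrow> enat \<Rightarrow> 'u gtensor" where
  "strict_cross U n = cross (Glob U n) (strict U n)"

definition is_strict_multitensor ::
    "('u set \<Rightarrow> bool) \<Rightarrow> enat \<Rightarrow> 'u gtensor \<Rightarrow> ('u gset list \<Rightarrow> 'u gmap) \<Rightarrow> bool" where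
  "is_strict_multitensor U n E \<epsilon> \<longleftrightarrow>
     is_multitensor (Glob U n) E \<and>
     is_multitensor_map (Glob U n) E (strict_cross U n) \<epsilon> \<and>
     is_cartesian_multi (Glob U n) E (strict_cross U n) \<epsilon>"

text \<open>\<open>\<Gamma>\<epsilon> \<cong> \<alpha>\<close> over \<open>T\<^sub>\<le>\<^sub>n\<^sub>+\<^sub>1\<close>.\<close>

definition corresponds ::
    "('u set \<Rightarrow> bool) \<Rightarrow> enat \<Rightarrow> 'u gtensor \<Rightarrow> ('u gset list \<Rightarrow> 'u gmap) \<Rightarrow>
     'u gmonad \<Rightarrow> ('u gset \<Rightarrow> 'u gmap) \<Rightarrow> bool" where
  "corresponds U n E \<epsilon> A \<alpha> \<longleftrightarrow>
     (\<exists>\<phi>. is_monad_map (Glob U (n + 1)) (Gamma (Glob U n) E) A \<phi> \<and>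
        (\<forall>X\<in>Obj (Glob U (n + 1)).
           is_iso (Glob U (n + 1)) (\<phi> X) \<and>
           \<alpha> X \<cdot>\<^bsub>Glob U (n + 1)\<^esub> \<phi> X = Gamma_map (Glob U n) E (strict_cross U n) \<epsilon> X))"

text \<open>The sequence \<open>(Z\<^sub>1,\<dots>,Z\<^sub>n)\<close> as a graph with objects \<open>0,\<dots>,n\<close>.\<close>

definition seq_graph :: "'u gset list \<Rightarrow> 'u gset" where
  "seq_graph Zs = mk_graph (num ` {0..length Zs})
     (\<lambda>a b. if \<exists>j<length Zs. a = num j \<and> b = num (Suc j)
            then Zs ! (THE j. j < length Zs \<and> a = num j) else void)"

text \<open>The morphism \<open>(i) : (S) \<rightarrow> (B)\<close>; note that \<open>void_map\<close> is the identity of \<open>void\<close>.\<close>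

definition seq_map :: "'u gmap \<Rightarrow> 'u gmap" where
  "seq_map i = mk_map (seq_graph [dm i]) (seq_graph [cd i]) (\<lambda>x. x)
     (\<lambda>a b. if a = num 0 \<and> b = num 1 then i else void_map)"

text \<open>\<open>one_point\<close> is the one-element set, as well as the one-object graph with empty hom.\<close>

definition one_point :: "'u gset" where
  "one_point = Gset {num 0} (\<lambda>_ _. void)"

definition two_points :: "'u gset" where
  "two_points = Gset {num 0, num 1} (\<lambda>_ _. void)"

definition empty_to_point :: "'u gmap" where
  "empty_to_point = Gmap void one_point (\<lambda>_. undefined) (\<lambda>_ _. void_map)"

definition fold_points :: "'u gmap" where
  "fold_points = mk_map two_points one_point (\<lambda>_. num 0) (\<lambda>_ _. void_map)"

definition plus_class :: "'u gmap set \<Rightarrow> 'u gmap set" where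
  "plus_class \<I> = insert empty_to_point (seq_map ` \<I>)"

primrec gen_fin :: "nat \<Rightarrow> 'u gmap set" where
  "gen_fin 0 = {empty_to_point, fold_points}"
| "gen_fin (Suc n) = plus_class (gen_fin n)"

text \<open>The \<open>(k+1)\<close>-globe has two 0-cells, with a \<open>k\<close>-globe from the first to the second.\<close>

primrec boundary_inclusion :: "nat \<Rightarrow> 'u gmap" where
  "boundary_inclusion 0 = empty_to_point"
| "boundary_inclusion (Suc k) = seq_map (boundary_inclusion k)"

definition gen :: "enat \<Rightarrow> 'u gmap set" where
  "gen n = (case n of enat k \<Rightarrow> gen_fin k | \<infinity> \<Rightarrow> range boundary_inclusion)"

definition contractible_operad :: "('u set \<Rightarrow> bool) \<Rightarrow> enat \<Rightarrow> ('u gset \<Rightarrow> 'u gmap) \<Rightarrow> bool" where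
  "contractible_operad U n \<alpha> \<longleftrightarrow>
     (\<forall>X\<in>Obj (Glob U n). trivial_fibration (Glob U n) (gen n) (\<alpha> X))"

definition contractible_multitensor ::
    "('u set \<Rightarrow> bool) \<Rightarrow> enat \<Rightarrow> ('u gset list \<Rightarrow> 'u gmap) \<Rightarrow> bool" where
  "contractible_multitensor U n \<epsilon> \<longleftrightarrow>
     (\<forall>Xs\<in>lists (Obj (Glob U n)). trivial_fibration (Glob U n) (gen n) (\<epsilon> Xs))"


section \<open>The identifications for \<open>n = \<infinity>\<close>\<close>

text \<open>The three lemmas \<open>Glob_Suc\<close>, \<open>gen_Suc\<close> and \<open>strict_Suc\<close> hold by definition for finite
  \<open>n\<close>; for \<open>n = \<infinity>\<close> they say that globular sets, their boundary inclusions and the free strict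
  \<open>\<omega>\<close>-categories on them are fixed points of the constructions for finite \<open>n\<close>.\<close>

lemma Sets_simps [simp]:
  "Obj (Sets U) = {X. U (ob X) \<and> hm X = (\<lambda>_ _. void)}"
  "Dom (Sets U) = dm" "Cod (Sets U) = cd"
  by (simp_all add: Sets_def Let_def)

lemma Graphs_simps [simp]:
  "Obj (Graphs U V) = {X. U (ob X) \<and>
     (\<forall>a b. if a \<in> ob X \<and> b \<in> ob X then hm X a b \<in> Obj V else hm X a b = void)}"
  "Dom (Graphs U V) = dm" "Cod (Graphs U V) = cd"
  by (simp_all add: Graphs_def Let_def)

lemma Glob_fin_Dom [simp]: "Dom (Glob_fin U n) = dm" "Cod (Glob_fin U n) = cd"
  by (cases n; simp)+

lemma Glob_lim_Dom [simp]: "Dom (Glob_lim U) = dm" "Cod (Glob_lim U) = cd"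
  by (simp_all add: Glob_lim_def)

lemma ob_trunc [simp]: "ob (trunc n X) = ob X"
  by (cases n) auto

lemma trunc_map_sel [simp]: "dm (trunc_map n f) = trunc n (dm f)" "cd (trunc_map n f) = trunc n (cd f)"
  "obm (trunc_map n f) = obm f"
  by (cases n; simp)+

lemma glue_trunc [simp]: "glue (\<lambda>n. trunc n X) = X"
  by (coinduction arbitrary: X) (auto simp: rel_fun_def)

lemma glue_map_trunc_map [simp]: "glue_map (\<lambda>n. trunc_map n f) = f"
  by (coinduction arbitrary: f) (auto simp: rel_fun_def)

lemma trunc_trunc: "trunc n (trunc (Suc n) X) = trunc n X"
  by (induction n arbitrary: X) simp_all

lemma glue_void [simp]: "glue (\<lambda>n. void) = void"
  by (coinduction) (auto simp: rel_fun_def)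

lemma glue_map_void [simp]: "glue_map (\<lambda>n. void_map) = void_map"
  by (coinduction) (auto simp: rel_fun_def)

lemma Gset_void: "Gset {} (\<lambda>_ _. void) = void"
  by (rule gset.expand) auto

lemma Gmap_void: "Gmap void void (\<lambda>_. undefined) (\<lambda>_ _. void_map) = void_map"
  by (rule gmap.expand) auto

lemma trunc_void [simp]: "trunc n void = void"
  by (induction n) (auto simp: Gset_void)

lemma trunc_void_map [simp]: "trunc_map n void_map = void_map"
  by (induction n) (auto simp: Gset_void Gmap_void)

lemma all_trunc_void: "(\<forall>n. trunc n X = void) \<longleftrightarrow> X = void"
  by (metis (full_types) glue_trunc glue_void ext trunc_void)

lemma all_trunc_map_void: "(\<forall>n. trunc_map n X = void_map) \<longleftrightarrow> X = void_map"
  by (metis (full_types) glue_map_trunc_map glue_map_void ext trunc_void_map)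

lemma all_trunc_eq: "(\<forall>n. trunc n X = trunc n Y) \<longleftrightarrow> X = Y"
  by (metis (full_types) glue_trunc ext)

lemma all_nat_Suc: "(\<forall>n. P n) \<longleftrightarrow> P 0 \<and> (\<forall>n. P (Suc n))"
  by (metis not0_implies_Suc)

lemma hm_trunc_Suc [simp]: "hm (trunc (Suc n) X) a b = trunc n (hm X a b)"
  by simp

lemma Obj_lim: "Obj (Glob_lim U) = Obj (Graphs U (Glob_lim U))" (is "?L = ?R")
proof -
  have "X \<in> ?L \<longleftrightarrow> X \<in> ?R" for X
  proof -
    have "X \<in> ?L \<longleftrightarrow> U (ob X) \<and> (\<forall>n a b. if a \<in> ob X \<and> b \<in> ob X then trunc n (hm X a b) \<in> Obj (Glob_fin U n) else trunc n (hm X a b) = void)"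
      unfolding Glob_lim_def by (simp, subst all_nat_Suc, auto)
    also have "\<dots> \<longleftrightarrow> U (ob X) \<and> (\<forall>a b. if a \<in> ob X \<and> b \<in> ob X then (\<forall>n. trunc n (hm X a b) \<in> Obj (Glob_fin U n)) else (\<forall>n. trunc n (hm X a b) = void))"
      by (metis (no_types, opaque_lifting))
    also have "\<dots> \<longleftrightarrow> X \<in> ?R"
      unfolding all_trunc_void Glob_lim_def by simp
    finally show ?thesis .
  qed
  then show ?thesis by blast
qed

lemma Arr_lim: "Arr (Glob_lim U) = Arr (Graphs U (Glob_lim U))" (is "?L = ?R")
proof -
  have "f \<in> ?L \<longleftrightarrow> f \<in> ?R" for f
  proof -
    let ?P = "\<lambda>a b. a \<in> ob (dm f) \<and> b \<in> ob (dm f)"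
    let ?h = "\<lambda>n a b. trunc_map n (hmm f a b) \<in> Hom (Glob_fin U n) (trunc n (hm (dm f) a b)) (trunc n (hm (cd f) (obm f a) (obm f b)))"
    have A0: "trunc_map 0 f \<in> Arr (Glob_fin U 0) \<longleftrightarrow> trunc 0 (dm f) \<in> Obj (Glob_fin U 0) \<and> trunc 0 (cd f) \<in> Obj (Glob_fin U 0) \<and> obm f \<in> ob (dm f) \<rightarrow>\<^sub>E ob (cd f)"
      by (auto simp: Sets_def Let_def)
    have AS: "trunc_map (Suc n) f \<in> Arr (Glob_fin U (Suc n)) \<longleftrightarrow> trunc (Suc n) (dm f) \<in> Obj (Glob_fin U (Suc n)) \<and> trunc (Suc n) (cd f) \<in> Obj (Glob_fin U (Suc n)) \<and> obm f \<in> ob (dm f) \<rightarrow>\<^sub>E ob (cd f) \<and> (\<forall>a b. if ?P a b then ?h n a b else trunc_map n (hmm f a b) = void_map)" for n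
      unfolding Glob_fin.simps by (simp add: Graphs_def Let_def)
    have "f \<in> ?L \<longleftrightarrow> (\<forall>n. trunc n (dm f) \<in> Obj (Glob_fin U n)) \<and> (\<forall>n. trunc n (cd f) \<in> Obj (Glob_fin U n)) \<and> obm f \<in> ob (dm f) \<rightarrow>\<^sub>E ob (cd f) \<and> (\<forall>n a b. if ?P a b then ?h n a b else trunc_map n (hmm f a b) = void_map)"
      unfolding Glob_lim_def pc_category.simps category.simps mem_Collect_eq
      unfolding all_nat_Suc[of "\<lambda>n. trunc_map n f \<in> Arr (Glob_fin U n)"] A0 AS
        all_nat_Suc[of "\<lambda>n. trunc n (dm f) \<in> Obj (Glob_fin U n)"]
        all_nat_Suc[of "\<lambda>n. trunc n (cd f) \<in> Obj (Glob_fin U n)"]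
      by blast
    also have "\<dots> \<longleftrightarrow> dm f \<in> Obj (Glob_lim U) \<and> cd f \<in> Obj (Glob_lim U) \<and> obm f \<in> ob (dm f) \<rightarrow>\<^sub>E ob (cd f) \<and> (\<forall>a b. if ?P a b then (\<forall>n. ?h n a b) else (\<forall>n. trunc_map n (hmm f a b) = void_map))"
      by (auto simp: Glob_lim_def)
    also have "\<dots> \<longleftrightarrow> dm f \<in> Obj (Glob_lim U) \<and> cd f \<in> Obj (Glob_lim U) \<and> obm f \<in> ob (dm f) \<rightarrow>\<^sub>E ob (cd f) \<and> (\<forall>a b. if ?P a b then hmm f a b \<in> Hom (Glob_lim U) (hm (dm f) a b) (hm (cd f) (obm f a) (obm f b)) else hmm f a b = void_map)"
    proof -
      have "(\<forall>n. ?h n a b) \<longleftrightarrow> hmm f a b \<in> Hom (Glob_lim U) (hm (dm f) a b) (hm (cd f) (obm f a) (obm f b))" for a b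
        unfolding Hom_def mem_Collect_eq Glob_fin_Dom Glob_lim_Dom trunc_map_sel all_conj_distrib all_trunc_eq
        by (simp add: Glob_lim_def)
      then show ?thesis unfolding all_trunc_map_void by presburger
    qed
    also have "\<dots> \<longleftrightarrow> f \<in> ?R"
      unfolding Obj_lim by (simp add: Graphs_def Let_def)
    finally show ?thesis .
  qed
  then show ?thesis by blast
qed

lemma fin_sel:
  "dm (Id (Glob_fin U n) X) = X" "cd (Id (Glob_fin U n) X) = X"
  "obm (Id (Glob_fin U n) X) = restrict (\<lambda>x. x) (ob X)"
  "dm (Cmp (Glob_fin U n) g f) = dm f" "cd (Cmp (Glob_fin U n) g f) = cd g"
  "obm (Cmp (Glob_fin U n) g f) = restrict (\<lambda>x. obm g (obm f x)) (ob (dm f))"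
  "ob (Prd (Glob_fin U n) Xs) = tuples (map ob Xs)"
  "ob (Cop (Glob_fin U n) I F) = tagged I (\<lambda>i. ob (F i))"
  "i < length Xs \<Longrightarrow> dm (Prj (Glob_fin U n) Xs i) = Prd (Glob_fin U n) Xs"
  "i < length Xs \<Longrightarrow> cd (Prj (Glob_fin U n) Xs i) = Xs ! i"
  "i < length Xs \<Longrightarrow> obm (Prj (Glob_fin U n) Xs i) = restrict (\<lambda>c. untup c ! i) (tuples (map ob Xs))"
  "\<not> i < length Xs \<Longrightarrow> Prj (Glob_fin U n) Xs i = void_map"
  "dm (Inj (Glob_fin U n) I F i') = F i'" "cd (Inj (Glob_fin U n) I F i') = Cop (Glob_fin U n) I F"
  "obm (Inj (Glob_fin U n) I F i') = restrict (tag i') (ob (F i'))"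
  by (cases n; simp add: Sets_def Graphs_def Let_def mk_map_def mk_graph_def)+

lemma gset_eqI: "ob X = ob Y \<Longrightarrow> (\<And>a b. hm X a b = hm Y a b) \<Longrightarrow> X = Y"
  by (rule gset.expand) (auto intro!: ext)
lemma gmap_eqI: "dm f = dm g \<Longrightarrow> cd f = cd g \<Longrightarrow> obm f = obm g \<Longrightarrow> (\<And>a b. hmm f a b = hmm g a b) \<Longrightarrow> f = g"
  by (rule gmap.expand) (auto intro!: ext)

lemma glue_if: "glue (\<lambda>n. if b then X n else void) = (if b then glue X else void)" by simp
lemma glue_map_if: "glue_map (\<lambda>n. if b then X n else void_map) = (if b then glue_map X else void_map)" by simp

lemma components_trunc: "components (map (trunc (Suc n)) Xs) c d = map (trunc n) (components Xs c d)"
  by (simp add: components_def)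

lemma fin_Suc_hm:
  "hmm (Id (Glob_fin U (Suc n)) X) a b = (if a \<in> ob X \<and> b \<in> ob X then Id (Glob_fin U n) (hm X a b) else void_map)"
  "hmm (Cmp (Glob_fin U (Suc n)) g f) a b = (if a \<in> ob (dm f) \<and> b \<in> ob (dm f) then Cmp (Glob_fin U n) (hmm g (obm f a) (obm f b)) (hmm f a b) else void_map)"
  "hm (Prd (Glob_fin U (Suc n)) Xs) a b = (if a \<in> tuples (map ob Xs) \<and> b \<in> tuples (map ob Xs) then Prd (Glob_fin U n) (components Xs a b) else void)"
  "i < length Xs \<Longrightarrow> hmm (Prj (Glob_fin U (Suc n)) Xs i) a b = (if a \<in> tuples (map ob Xs) \<and> b \<in> tuples (map ob Xs) then Prj (Glob_fin U n) (components Xs a b) i else void_map)"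
  "hm (Cop (Glob_fin U (Suc n)) I F) a b = (if a \<in> tagged I (\<lambda>i. ob (F i)) \<and> b \<in> tagged I (\<lambda>i. ob (F i)) then
     if tag_index a = tag_index b then hm (F (tag_index a)) (tag_elem a) (tag_elem b) else void else void)"
  "hmm (Inj (Glob_fin U (Suc n)) I F j) a b = (if a \<in> ob (F j) \<and> b \<in> ob (F j) then Id (Glob_fin U n) (hm (F j) a b) else void_map)"
  by (simp_all add: Graphs_def Let_def mk_map_def mk_graph_def)

lemma Graphs_Glob_lim: "Graphs U (Glob_lim U) = Glob_lim U"
proof (rule pc_category.equality)
  show "Obj (Graphs U (Glob_lim U)) = Obj (Glob_lim U)" by (rule Obj_lim[symmetric])
  show "Arr (Graphs U (Glob_lim U)) = Arr (Glob_lim U)" by (rule Arr_lim[symmetric])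
  show "Dom (Graphs U (Glob_lim U)) = Dom (Glob_lim U)" by simp
  show "Cod (Graphs U (Glob_lim U)) = Cod (Glob_lim U)" by simp
  show "Id (Graphs U (Glob_lim U)) = Id (Glob_lim U)"
    by (rule ext, rule gmap_eqI)
      (simp_all add: Graphs_def Let_def Glob_lim_def mk_map_def fin_sel fin_Suc_hm glue_map_if del: Glob_fin.simps)
  show "Cmp (Graphs U (Glob_lim U)) = Cmp (Glob_lim U)"
    by (rule ext, rule ext, rule gmap_eqI)
      (simp_all add: Graphs_def Let_def Glob_lim_def mk_map_def fin_sel fin_Suc_hm glue_map_if del: Glob_fin.simps)
  show P: "Prd (Graphs U (Glob_lim U)) = Prd (Glob_lim U)"
    by (rule ext, rule gset_eqI)
      (simp_all add: Graphs_def Let_def Glob_lim_def mk_graph_def fin_sel fin_Suc_hm glue_if components_trunc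
        o_def del: Glob_fin.simps)
  show Q: "Cop (Graphs U (Glob_lim U)) = Cop (Glob_lim U)"
    by (rule ext, rule ext, rule gset_eqI)
      (simp_all add: Graphs_def Let_def Glob_lim_def mk_graph_def fin_sel fin_Suc_hm glue_if del: Glob_fin.simps)
  show "Prj (Graphs U (Glob_lim U)) = Prj (Glob_lim U)"
  proof (rule ext, rule ext)
    fix Xs i
    show "Prj (Graphs U (Glob_lim U)) Xs i = Prj (Glob_lim U) Xs i"
    proof (cases "i < length Xs")
      case True
      show ?thesis
        by (rule gmap_eqI) (use True fun_cong[OF P, of Xs] in
          \<open>simp_all add: Graphs_def Let_def Glob_lim_def mk_map_def fin_sel fin_Suc_hm glue_map_if o_def
            components_trunc del: Glob_fin.simps\<close>)
    qed (simp add: Graphs_def Let_def Glob_lim_def fin_sel del: Glob_fin.simps)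
  qed
  show "Inj (Graphs U (Glob_lim U)) = Inj (Glob_lim U)"
  proof (rule ext, rule ext, rule ext)
    fix I F i
    show "Inj (Graphs U (Glob_lim U)) I F i = Inj (Glob_lim U) I F i"
      by (rule gmap_eqI) (use fun_cong[OF fun_cong[OF Q, of I], of F] in
          \<open>simp_all add: Graphs_def Let_def Glob_lim_def mk_map_def fin_sel fin_Suc_hm glue_map_if
            del: Glob_fin.simps\<close>)
  qed
qed simp

lemma Glob_Suc: "Glob U (n + 1) = Graphs U (Glob U n)"
  by (cases n) (simp_all add: Glob_def one_enat_def Graphs_Glob_lim)

lemma gen_Suc: "gen (n + 1) = plus_class (gen n)"
proof (cases n)
  case infinity
  have "range boundary_inclusion = insert (boundary_inclusion 0) (range (\<lambda>k. boundary_inclusion (Suc k)))"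
    by (metis UNIV_nat_eq image_image image_insert)
  then show ?thesis using infinity by (auto simp: gen_def plus_class_def image_image)
qed (simp add: gen_def one_enat_def)


lemma trunc_if: "trunc n (if b then X else void) = (if b then trunc n X else void)" by simp

lemma trunc_Cop: "trunc n (Cop (Glob_fin U (Suc n)) I F) = Cop (Glob_fin U n) I (\<lambda>i. trunc n (F i))"
proof (cases n)
  case 0
  have *: "hm (Cop (Glob_fin U 0) I G) a b = void" for G a b
    by (simp add: Sets_def Let_def)
  show ?thesis
    unfolding 0 by (rule gset_eqI) (simp_all add: fin_sel * del: Glob_fin.simps)
next
  case (Suc m)
  show ?thesis
    unfolding Suc
    by (rule gset_eqI) (simp_all add: fin_sel fin_Suc_hm trunc_if del: Glob_fin.simps)
qed

lemma trunc_Prd: "trunc n (Prd (Glob_fin U (Suc n)) Xs) = Prd (Glob_fin U n) (map (trunc n) Xs)"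
proof (induction n arbitrary: Xs)
  case 0
  have *: "hm (Prd (Glob_fin U 0) Ys) a b = void" for Ys :: "'a gset list" and a b
    by (simp add: Sets_def Let_def)
  show ?case
    by (rule gset_eqI) (simp_all add: fin_sel o_def * del: Glob_fin.simps)
next
  case (Suc m)
  show ?case
    by (rule gset_eqI)
       (simp_all add: fin_sel fin_Suc_hm trunc_if o_def components_trunc Suc
         del: Glob_fin.simps trunc.simps(2))
qed

lemma homs_trunc: "homs (trunc (Suc n) X) p = map (trunc n) (homs X p)"
  by (simp add: homs_def split_def)

lemma paths_trunc [simp]: "paths (trunc n X) = paths X"
  by (simp add: paths_def fun_eq_iff)

lemma Gamma_obj_sel:
  "ob (Gamma_obj V E X) = ob X"
  "hm (Gamma_obj V E X) a b = (if a \<in> ob X \<and> b \<in> ob X then Cop V (paths X a b) (\<lambda>p. Mo E (homs X p)) else void)"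
  by (simp_all add: Gamma_obj_def mk_graph_def)

lemma ob_strict_fin: "ob (Fo (strict_fin U n) X) = ob X"
  by (cases n) (simp_all add: id_monad_def Gamma_def Let_def Gamma_obj_sel)

lemma hm_strict_fin:
  "hm (Fo (strict_fin U (Suc n)) X) a b = (if a \<in> ob X \<and> b \<in> ob X then
     Cop (Glob_fin U n) (paths X a b) (\<lambda>p. Prd (Glob_fin U n) (map (Fo (strict_fin U n)) (homs X p))) else void)"
  by (simp add: Gamma_def Let_def Gamma_obj_sel cross_def)

lemma trunc_strict_fin: "trunc n (Fo (strict_fin U (Suc n)) (trunc (Suc n) X)) = Fo (strict_fin U n) (trunc n X)"
proof (induction n arbitrary: X)
  case 0
  show ?case
    by (rule gset_eqI) (simp_all add: ob_strict_fin id_monad_def del: strict_fin.simps(2))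
next
  case (Suc n)
  show ?case
    by (rule gset_eqI)
       (simp_all add: ob_strict_fin hm_strict_fin trunc_if trunc_Cop trunc_Prd homs_trunc Suc o_def
         del: Glob_fin.simps strict_fin.simps trunc.simps(2))
qed

lemma trunc_glue:
  assumes "\<And>n. trunc n (X (Suc n)) = X n"
  shows "trunc n (glue X) = X n"
  using assms
proof (induction n arbitrary: X)
  case 0
  have "X 0 = trunc 0 (X 1)" using 0[of 0] by simp
  then have "hm (X 0) a b = void" for a b by simp
  then show ?case using gset_eqI[of "trunc 0 (glue X)" "X 0"] by simp
next
  case (Suc n)
  note coh = Suc.prems
  have "trunc n (glue (\<lambda>n. hm (X (Suc n)) a b)) = hm (X (Suc n)) a b" for a b
    by (rule Suc.IH) (simp only: hm_trunc_Suc[symmetric] coh)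
  moreover have "ob (X 0) = ob (X k)" for k
    by (induction k) (simp, metis coh ob_trunc)
  ultimately show ?case using gset_eqI[of "trunc (Suc n) (glue X)" "X (Suc n)"] by simp
qed

lemma trunc_strict_lim: "trunc n (Fo (strict_lim U) X) = Fo (strict_fin U n) (trunc n X)"
  unfolding strict_lim_def by (simp add: trunc_glue trunc_strict_fin del: strict_fin.simps trunc.simps)

lemma trunc_Prd_lim: "trunc n (Prd (Glob_lim U) Xs) = Prd (Glob_fin U n) (map (trunc n) Xs)"
proof -
  let ?X = "\<lambda>n. Prd (Glob_fin U n) (map (trunc n) Xs)"
  have "trunc n (?X (Suc n)) = ?X n" for n
    unfolding trunc_Prd map_map o_def trunc_trunc ..
  then have "trunc n (glue ?X) = ?X n" by (rule trunc_glue)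
  then show ?thesis by (simp only: Glob_lim_def pc_category.simps)
qed

lemma Cop_lim: "Cop (Glob_lim U) I F = glue (\<lambda>n. Cop (Glob_fin U n) I (\<lambda>i. trunc n (F i)))"
  by (simp add: Glob_lim_def)

lemma Fo_strict_lim: "Fo (strict_lim U) = Fo (Gamma (Glob_lim U) (cross (Glob_lim U) (strict_lim U)))"
proof
  fix X
  show "Fo (strict_lim U) X = Fo (Gamma (Glob_lim U) (cross (Glob_lim U) (strict_lim U))) X"
  proof (rule gset_eqI)
    fix a b
    have "hm (Fo (strict_lim U) X) a b = glue (\<lambda>n. hm (Fo (strict_fin U (Suc n)) (trunc (Suc n) X)) a b)"
      by (simp add: strict_lim_def del: strict_fin.simps trunc.simps)
    also have "\<dots> = (if a \<in> ob X \<and> b \<in> ob X then glue (\<lambda>n. Cop (Glob_fin U n) (paths X a b)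
        (\<lambda>p. Prd (Glob_fin U n) (map (\<lambda>Y. Fo (strict_fin U n) (trunc n Y)) (homs X p)))) else void)"
      unfolding hm_strict_fin homs_trunc paths_trunc ob_trunc glue_if by (simp only: map_map o_def)
    also have "\<dots> = (if a \<in> ob X \<and> b \<in> ob X then Cop (Glob_lim U) (paths X a b)
        (\<lambda>p. Prd (Glob_lim U) (map (Fo (strict_lim U)) (homs X p))) else void)"
      unfolding Cop_lim trunc_Prd_lim map_map o_def trunc_strict_lim ..
    also have "\<dots> = hm (Fo (Gamma (Glob_lim U) (cross (Glob_lim U) (strict_lim U))) X) a b"
      by (simp add: Gamma_def Let_def cross_def Gamma_obj_sel)
    finally show "hm (Fo (strict_lim U) X) a b =
      hm (Fo (Gamma (Glob_lim U) (cross (Glob_lim U) (strict_lim U))) X) a b" .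
  qed (simp add: strict_lim_def id_monad_def Gamma_def Let_def Gamma_obj_sel)
qed

lemma strict_Suc: "Fo (strict U (n + 1)) = Fo (Gamma (Glob U n) (strict_cross U n))"
  by (cases n) (simp_all add: strict_def strict_cross_def Glob_def one_enat_def Fo_strict_lim)

end

theory Submission
  imports Defs
begin

text \<open>Transport along the isomorphism \<open>\<Gamma>\<epsilon> \<cong> \<alpha>\<close> reduces contractibility of \<open>\<alpha>\<close> to lifting
  properties of \<open>\<Gamma>\<epsilon>\<close>. As \<open>\<Gamma>\<epsilon>\<close> is the identity on objects, it lifts against \<open>\<emptyset> \<rightarrow> 0\<close>, and it
  lifts against \<open>(i) : (S) \<rightarrow> (B)\<close> iff each of its hom maps lifts against \<open>i\<close>. The hom map at \<open>(a,b)\<close>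
  is the coproduct over all paths \<open>p\<close> from \<open>a\<close> to \<open>b\<close> of the components of \<open>\<epsilon>\<close> at the homs along
  \<open>p\<close>. Since \<open>B\<close> is a globe, hence connected and nonempty, and coproducts are disjoint unions, a coproduct
  of maps lifts against \<open>i\<close> iff each summand does. Finally, every sequence of objects occurs as the homs
  along a path, namely in the graph that is this sequence.\<close>

section \<open>Categories of graphs\<close>

text \<open>Categories on \<open>'u gset\<close> and \<open>'u gmap\<close> with \<open>void\<close>
  as initial object. Sets, graphs, globular sets and the one-object category on \<open>void\<close>
  are all instances, so one theory of graphs serves every dimension. With
  \<open>void_Hom_unique\<close>, \<open>void_map_Hom\<close> makes \<open>void_map\<close> the
  identity of \<open>void\<close>; \<open>seq_map\<close> relies on this where it puts
  \<open>void_map\<close> between initial homs.\<close>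

locale gcategory =
  fixes V :: "'u gcat"
  assumes Dom_eq: "Dom V = dm" and Cod_eq: "Cod V = cd"
    and Arr_Obj: "f \<in> Arr V \<Longrightarrow> dm f \<in> Obj V \<and> cd f \<in> Obj V"
    and Id_Hom: "X \<in> Obj V \<Longrightarrow> Id V X \<in> Hom V X X"
    and Cmp_Hom: "f \<in> Hom V X Y \<Longrightarrow> g \<in> Hom V Y Z \<Longrightarrow> g \<cdot>\<^bsub>V\<^esub> f \<in> Hom V X Z"
    and Id_left: "f \<in> Hom V X Y \<Longrightarrow> Id V Y \<cdot>\<^bsub>V\<^esub> f = f"
    and Id_right: "f \<in> Hom V X Y \<Longrightarrow> f \<cdot>\<^bsub>V\<^esub> Id V X = f"
    and Cmp_assoc: "f \<in> Hom V X Y \<Longrightarrow> g \<in> Hom V Y Z \<Longrightarrow> h \<in> Hom V Z W \<Longrightarrow>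
      h \<cdot>\<^bsub>V\<^esub> (g \<cdot>\<^bsub>V\<^esub> f) = (h \<cdot>\<^bsub>V\<^esub> g) \<cdot>\<^bsub>V\<^esub> f"
    and void_Obj: "void \<in> Obj V"
    and void_map_Hom: "void_map \<in> Hom V void void"
    and void_Hom_ex: "X \<in> Obj V \<Longrightarrow> \<exists>f. f \<in> Hom V void X"
    and void_Hom_unique: "f \<in> Hom V void X \<Longrightarrow> g \<in> Hom V void X \<Longrightarrow> f = g"
begin

definition from_void :: "'u gset \<Rightarrow> 'u gmap" where
  "from_void X = (SOME f. f \<in> Hom V void X)"

lemma from_void_Hom: "X \<in> Obj V \<Longrightarrow> from_void X \<in> Hom V void X"
  unfolding from_void_def using void_Hom_ex by (rule someI_ex)

lemma Hom_iff: "f \<in> Hom V X Y \<longleftrightarrow> f \<in> Arr V \<and> dm f = X \<and> cd f = Y"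
  by (auto simp: Hom_def Dom_eq Cod_eq)

lemma Hom_Obj: "f \<in> Hom V X Y \<Longrightarrow> X \<in> Obj V \<and> Y \<in> Obj V"
  using Arr_Obj by (auto simp: Hom_iff)

lemma Hom_self: "f \<in> Arr V \<Longrightarrow> f \<in> Hom V (dm f) (cd f)"
  by (simp add: Hom_iff)

lemma has_rlp_iff: "has_rlp V f j \<longleftrightarrow>
    (\<forall>u\<in>Hom V (dm j) (dm f). \<forall>v\<in>Hom V (cd j) (cd f). f \<cdot>\<^bsub>V\<^esub> u = v \<cdot>\<^bsub>V\<^esub> j \<longrightarrow>
      (\<exists>d\<in>Hom V (cd j) (dm f). d \<cdot>\<^bsub>V\<^esub> j = u \<and> f \<cdot>\<^bsub>V\<^esub> d = v))"
  by (simp add: has_rlp_def Dom_eq Cod_eq)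

text \<open>With \<open>l\<close> inverse to \<open>k\<close>, a problem \<open>(u, v)\<close> for
  \<open>f\<close> becomes \<open>(l u, v)\<close> for the composite, and a lift \<open>d\<close> of
  the latter yields \<open>k d\<close>; in the other direction \<open>k\<close> and \<open>l\<close>
  change places. This is the transport along the isomorphism of operads.\<close>

lemma has_rlp_iso:
  assumes f: "f \<in> Hom V X Y" and k: "k \<in> Hom V W X" "is_iso V k" and j: "j \<in> Arr V"
  shows "has_rlp V (f \<cdot>\<^bsub>V\<^esub> k) j \<longleftrightarrow> has_rlp V f j"
proof -
  obtain l where l: "l \<in> Hom V X W" "l \<cdot>\<^bsub>V\<^esub> k = Id V W" "k \<cdot>\<^bsub>V\<^esub> l = Id V X"
    using k by (auto simp: is_iso_def Hom_iff Dom_eq Cod_eq)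
  note jj = Hom_self[OF j]
  have fk: "f \<cdot>\<^bsub>V\<^esub> k \<in> Hom V W Y" using k f by (auto intro: Cmp_Hom)
  have d: "dm f = X" "cd f = Y" "dm (f \<cdot>\<^bsub>V\<^esub> k) = W" "cd (f \<cdot>\<^bsub>V\<^esub> k) = Y"
    using f fk by (auto simp: Hom_iff)
  show ?thesis
    unfolding has_rlp_iff d
  proof (intro iffI ballI impI)
    fix u v
    assume H: "\<forall>u\<in>Hom V (dm j) W. \<forall>v\<in>Hom V (cd j) Y. (f \<cdot>\<^bsub>V\<^esub> k) \<cdot>\<^bsub>V\<^esub> u = v \<cdot>\<^bsub>V\<^esub> j \<longrightarrow>
        (\<exists>d\<in>Hom V (cd j) W. d \<cdot>\<^bsub>V\<^esub> j = u \<and> (f \<cdot>\<^bsub>V\<^esub> k) \<cdot>\<^bsub>V\<^esub> d = v)"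
      and u: "u \<in> Hom V (dm j) X" and v: "v \<in> Hom V (cd j) Y" and sq: "f \<cdot>\<^bsub>V\<^esub> u = v \<cdot>\<^bsub>V\<^esub> j"
    have kl: "k \<cdot>\<^bsub>V\<^esub> (l \<cdot>\<^bsub>V\<^esub> u) = u"
      using Cmp_assoc[OF u l(1) k(1)] l(3) Id_left[OF u] by simp
    have "(f \<cdot>\<^bsub>V\<^esub> k) \<cdot>\<^bsub>V\<^esub> (l \<cdot>\<^bsub>V\<^esub> u) = v \<cdot>\<^bsub>V\<^esub> j"
      using Cmp_assoc[OF Cmp_Hom[OF u l(1)] k(1) f] kl sq by simp
    then obtain d where d: "d \<in> Hom V (cd j) W" "d \<cdot>\<^bsub>V\<^esub> j = l \<cdot>\<^bsub>V\<^esub> u" "(f \<cdot>\<^bsub>V\<^esub> k) \<cdot>\<^bsub>V\<^esub> d = v"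
      using H Cmp_Hom[OF u l(1)] v by blast
    show "\<exists>d\<in>Hom V (cd j) X. d \<cdot>\<^bsub>V\<^esub> j = u \<and> f \<cdot>\<^bsub>V\<^esub> d = v"
    proof (intro bexI conjI)
      show "k \<cdot>\<^bsub>V\<^esub> d \<in> Hom V (cd j) X" using d k by (auto intro: Cmp_Hom)
      show "(k \<cdot>\<^bsub>V\<^esub> d) \<cdot>\<^bsub>V\<^esub> j = u" using Cmp_assoc[OF jj d(1) k(1)] d(2) kl by simp
      show "f \<cdot>\<^bsub>V\<^esub> (k \<cdot>\<^bsub>V\<^esub> d) = v" using Cmp_assoc[OF d(1) k(1) f] d(3) by simp
    qed
  next
    fix u v
    assume H: "\<forall>u\<in>Hom V (dm j) X. \<forall>v\<in>Hom V (cd j) Y. f \<cdot>\<^bsub>V\<^esub> u = v \<cdot>\<^bsub>V\<^esub> j \<longrightarrow>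
        (\<exists>d\<in>Hom V (cd j) X. d \<cdot>\<^bsub>V\<^esub> j = u \<and> f \<cdot>\<^bsub>V\<^esub> d = v)"
      and u: "u \<in> Hom V (dm j) W" and v: "v \<in> Hom V (cd j) Y" and sq: "(f \<cdot>\<^bsub>V\<^esub> k) \<cdot>\<^bsub>V\<^esub> u = v \<cdot>\<^bsub>V\<^esub> j"
    have "f \<cdot>\<^bsub>V\<^esub> (k \<cdot>\<^bsub>V\<^esub> u) = v \<cdot>\<^bsub>V\<^esub> j"
      using Cmp_assoc[OF u k(1) f] sq by simp
    then obtain d where d: "d \<in> Hom V (cd j) X" "d \<cdot>\<^bsub>V\<^esub> j = k \<cdot>\<^bsub>V\<^esub> u" "f \<cdot>\<^bsub>V\<^esub> d = v"
      using H Cmp_Hom[OF u k(1)] v by blast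
    show "\<exists>d\<in>Hom V (cd j) W. d \<cdot>\<^bsub>V\<^esub> j = u \<and> (f \<cdot>\<^bsub>V\<^esub> k) \<cdot>\<^bsub>V\<^esub> d = v"
    proof (intro bexI conjI)
      show ld: "l \<cdot>\<^bsub>V\<^esub> d \<in> Hom V (cd j) W" using d l by (auto intro: Cmp_Hom)
      show "(l \<cdot>\<^bsub>V\<^esub> d) \<cdot>\<^bsub>V\<^esub> j = u"
        using Cmp_assoc[OF jj d(1) l(1)] d(2) Cmp_assoc[OF u k(1) l(1)] l(2) Id_left[OF u] by simp
      show "(f \<cdot>\<^bsub>V\<^esub> k) \<cdot>\<^bsub>V\<^esub> (l \<cdot>\<^bsub>V\<^esub> d) = v"
        using Cmp_assoc[OF ld k(1) f] Cmp_assoc[OF d(1) l(1) k(1)] l(3) Id_left[OF d(1)] d(3) by simp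
    qed
  qed
qed

end

section \<open>Morphisms of enriched graphs\<close>

lemma Hom_Graphs_iff:
  "f \<in> Hom (Graphs U V) X Y \<longleftrightarrow>
     X \<in> Obj (Graphs U V) \<and> Y \<in> Obj (Graphs U V) \<and> dm f = X \<and> cd f = Y \<and>
     obm f \<in> ob X \<rightarrow>\<^sub>E ob Y \<and>
     (\<forall>a b. if a \<in> ob X \<and> b \<in> ob X then hmm f a b \<in> Hom V (hm X a b) (hm Y (obm f a) (obm f b))
        else hmm f a b = void_map)"
proof -
  have "f \<in> Arr (Graphs U V) \<longleftrightarrow>
     dm f \<in> Obj (Graphs U V) \<and> cd f \<in> Obj (Graphs U V) \<and> obm f \<in> ob (dm f) \<rightarrow>\<^sub>E ob (cd f) \<and>
     (\<forall>a b. if a \<in> ob (dm f) \<and> b \<in> ob (dm f)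
        then hmm f a b \<in> Hom V (hm (dm f) a b) (hm (cd f) (obm f a) (obm f b))
        else hmm f a b = void_map)"
    by (simp only: Graphs_def Let_def category.simps pc_category.simps mem_Collect_eq)
  then show ?thesis
    unfolding Hom_def[of "Graphs U V"] Graphs_simps(2,3) mem_Collect_eq by blast
qed

lemma mk_map_sel [simp]:
  "dm (mk_map X Y f h) = X" "cd (mk_map X Y f h) = Y" "obm (mk_map X Y f h) = restrict f (ob X)"
  "hmm (mk_map X Y f h) a b = (if a \<in> ob X \<and> b \<in> ob X then h a b else void_map)"
  by (simp_all add: mk_map_def)

lemma Graphs_Id: "Id (Graphs U V) X = mk_map X X (\<lambda>x. x) (\<lambda>a b. Id V (hm X a b))"
  by (simp add: Graphs_def Let_def)

lemma Graphs_Cmp: "Cmp (Graphs U V) g f = mk_map (dm f) (cd g) (\<lambda>x. obm g (obm f x))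
    (\<lambda>a b. hmm g (obm f a) (obm f b) \<cdot>\<^bsub>V\<^esub> hmm f a b)"
  by (simp add: Graphs_def Let_def)

lemma Hom_GraphsI:
  assumes "X \<in> Obj (Graphs U V)" "Y \<in> Obj (Graphs U V)" "\<And>x. x \<in> ob X \<Longrightarrow> f x \<in> ob Y"
    and "\<And>a b. a \<in> ob X \<Longrightarrow> b \<in> ob X \<Longrightarrow> h a b \<in> Hom V (hm X a b) (hm Y (f a) (f b))"
  shows "mk_map X Y f h \<in> Hom (Graphs U V) X Y"
  using assms by (simp add: Hom_Graphs_iff)

lemma Hom_GraphsD:
  assumes "f \<in> Hom (Graphs U V) X Y"
  shows "X \<in> Obj (Graphs U V)" "Y \<in> Obj (Graphs U V)" "dm f = X" "cd f = Y"
    "\<And>x. x \<in> ob X \<Longrightarrow> obm f x \<in> ob Y"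
    "\<And>a b. a \<in> ob X \<Longrightarrow> b \<in> ob X \<Longrightarrow> hmm f a b \<in> Hom V (hm X a b) (hm Y (obm f a) (obm f b))"
    "\<And>a b. \<not> (a \<in> ob X \<and> b \<in> ob X) \<Longrightarrow> hmm f a b = void_map"
  using assms unfolding Hom_Graphs_iff by (auto split: if_splits)

text \<open>Away from the objects of \<open>X\<close> both morphisms take the fixed default values
  \<open>undefined\<close> and \<open>void_map\<close>, so there is nothing to compare
  there.\<close>

lemma Hom_Graphs_eqI:
  assumes "f \<in> Hom (Graphs U V) X Y" "g \<in> Hom (Graphs U V) X Y"
    and "\<And>x. x \<in> ob X \<Longrightarrow> obm f x = obm g x"
    and "\<And>a b. a \<in> ob X \<Longrightarrow> b \<in> ob X \<Longrightarrow> hmm f a b = hmm g a b"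
  shows "f = g"
proof (rule gmap_eqI)
  show "dm f = dm g" "cd f = cd g" using assms(1,2) by (auto simp: Hom_Graphs_iff)
  show "obm f = obm g"
    by (rule PiE_ext[where k = "ob X" and s = "\<lambda>_. ob Y"])
      (use assms(1,2) in \<open>simp_all only: Hom_Graphs_iff assms(3)\<close>)
  show "hmm f a b = hmm g a b" for a b
  proof (cases "a \<in> ob X \<and> b \<in> ob X")
    case False
    then show ?thesis using Hom_GraphsD(7)[OF assms(1)] Hom_GraphsD(7)[OF assms(2)] by simp
  qed (use assms(4) in blast)
qed

lemma Obj_Graphs_hm: "X \<in> Obj (Graphs U V) \<Longrightarrow> a \<in> ob X \<Longrightarrow> b \<in> ob X \<Longrightarrow> hm X a b \<in> Obj V"
  by (auto split: if_splits)

text \<open>Some small set is infinite and so contains a copy of \<open>A\<close>; smallness passes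
  to subsets of images. This makes the empty graph, the one-object graph and the graphs of sequences
  small.\<close>

lemma universe_finite:
  assumes "universe U" "finite A"
  shows "U A"
proof -
  obtain B where B: "U B" "infinite B" using assms(1) by (auto simp: universe_def)
  obtain C where C: "C \<subseteq> B" "finite C" "card C = card A"
    using infinite_arbitrarily_large[OF B(2)] by metis
  then obtain f where "bij_betw f C A" using assms(2) finite_same_card_bij by blast
  then have "A \<subseteq> f ` B" using C(1) by (auto simp: bij_betw_def)
  moreover have "\<forall>A B f. U A \<and> B \<subseteq> f ` A \<longrightarrow> U B" using assms(1) by (simp add: universe_def)
  ultimately show ?thesis using B(1) by blast
qed

text \<open>The laws hold on objects and are inherited from \<open>V\<close> on each hom.
  \<open>U {}\<close> admits \<open>void\<close> as a graph; it is initial because a morphism out of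
  it has no values to choose.\<close>

lemma (in gcategory) gcategory_Graphs:
  assumes "U {}"
  shows "gcategory (Graphs U V)"
proof
  let ?G = "Graphs U V"
  show "Dom ?G = dm" "Cod ?G = cd" by simp_all
  show "dm f \<in> Obj ?G \<and> cd f \<in> Obj ?G" if "f \<in> Arr ?G" for f
    using that by (auto simp: Graphs_def Let_def)
  show I: "Id ?G X \<in> Hom ?G X X" if "X \<in> Obj ?G" for X
    unfolding Graphs_Id using that by (intro Hom_GraphsI) (auto intro: Id_Hom Obj_Graphs_hm)
  show C: "g \<cdot>\<^bsub>?G\<^esub> f \<in> Hom ?G X Z" if "f \<in> Hom ?G X Y" "g \<in> Hom ?G Y Z" for f g X Y Z
  proof -
    note f = Hom_GraphsD[OF that(1)] and g = Hom_GraphsD[OF that(2)]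
    show ?thesis
      unfolding Graphs_Cmp f(3) g(4)
      by (rule Hom_GraphsI[OF f(1) g(2)]) (use f(5,6) g(5,6) in \<open>blast intro: Cmp_Hom\<close>)+
  qed
  show "Id ?G Y \<cdot>\<^bsub>?G\<^esub> f = f" if f: "f \<in> Hom ?G X Y" for f X Y
  proof (rule Hom_Graphs_eqI[OF C[OF f I] f])
    note f = Hom_GraphsD[OF f]
    show "Y \<in> Obj ?G" by (rule f(2))
    show "obm (Id ?G Y \<cdot>\<^bsub>?G\<^esub> f) x = obm f x" if "x \<in> ob X" for x
      using that f by (simp add: Graphs_Cmp Graphs_Id)
    show "hmm (Id ?G Y \<cdot>\<^bsub>?G\<^esub> f) a b = hmm f a b" if "a \<in> ob X" "b \<in> ob X" for a b
      using that f(3-6) Id_left[OF f(6)[OF that]] by (simp add: Graphs_Cmp Graphs_Id)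
  qed
  show "f \<cdot>\<^bsub>?G\<^esub> Id ?G X = f" if f: "f \<in> Hom ?G X Y" for f X Y
  proof (rule Hom_Graphs_eqI[OF C[OF I f] f])
    note f = Hom_GraphsD[OF f]
    show "X \<in> Obj ?G" by (rule f(1))
    show "obm (f \<cdot>\<^bsub>?G\<^esub> Id ?G X) x = obm f x" if "x \<in> ob X" for x
      using that f by (simp add: Graphs_Cmp Graphs_Id)
    show "hmm (f \<cdot>\<^bsub>?G\<^esub> Id ?G X) a b = hmm f a b" if "a \<in> ob X" "b \<in> ob X" for a b
      using that f(3-6) Id_right[OF f(6)[OF that]] by (simp add: Graphs_Cmp Graphs_Id)
  qed
  show "h \<cdot>\<^bsub>?G\<^esub> (g \<cdot>\<^bsub>?G\<^esub> f) = h \<cdot>\<^bsub>?G\<^esub> g \<cdot>\<^bsub>?G\<^esub> f"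
    if fgh: "f \<in> Hom ?G X Y" "g \<in> Hom ?G Y Z" "h \<in> Hom ?G Z W" for f g h X Y Z W
  proof (rule Hom_Graphs_eqI[OF C[OF C[OF fgh(1,2)] fgh(3)] C[OF fgh(1) C[OF fgh(2,3)]]])
    note f = Hom_GraphsD[OF fgh(1)] and g = Hom_GraphsD[OF fgh(2)] and h = Hom_GraphsD[OF fgh(3)]
    show "obm (h \<cdot>\<^bsub>?G\<^esub> (g \<cdot>\<^bsub>?G\<^esub> f)) x = obm (h \<cdot>\<^bsub>?G\<^esub> g \<cdot>\<^bsub>?G\<^esub> f) x" if "x \<in> ob X" for x
      using that f g h by (simp add: Graphs_Cmp)
    show "hmm (h \<cdot>\<^bsub>?G\<^esub> (g \<cdot>\<^bsub>?G\<^esub> f)) a b = hmm (h \<cdot>\<^bsub>?G\<^esub> g \<cdot>\<^bsub>?G\<^esub> f) a b" if "a \<in> ob X" "b \<in> ob X" for a b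
    proof -
      have "hmm h (obm g (obm f a)) (obm g (obm f b)) \<cdot>\<^bsub>V\<^esub> (hmm g (obm f a) (obm f b) \<cdot>\<^bsub>V\<^esub> hmm f a b) =
        hmm h (obm g (obm f a)) (obm g (obm f b)) \<cdot>\<^bsub>V\<^esub> hmm g (obm f a) (obm f b) \<cdot>\<^bsub>V\<^esub> hmm f a b"
        by (intro Cmp_assoc[OF f(6) g(6) h(6)] f(5) g(5) that)
      then show ?thesis using that f(3-5) g(3-5) h(3-5) by (simp add: Graphs_Cmp)
    qed
  qed
  show "void \<in> Obj ?G" using assms by simp
  have e: "Gmap void X (\<lambda>_. undefined) (\<lambda>_ _. void_map) \<in> Hom ?G void X" if "X \<in> Obj ?G" for X
    using that assms by (auto simp: Hom_Graphs_iff)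
  show "void_map \<in> Hom ?G void void" using e[of void] assms by (simp add: Gmap_void)
  show "\<exists>f. f \<in> Hom ?G void X" if "X \<in> Obj ?G" for X using e[OF that] by blast
  show "f = g" if "f \<in> Hom ?G void X" "g \<in> Hom ?G void X" for f g X
    by (rule Hom_Graphs_eqI[OF that]) auto
qed

section \<open>Injective codes for lists and numerals\<close>

text \<open>An infinite type is equinumerous with its square, which gives a pairing
  \<open>pr\<close>. Iterated pairing separates only lists of equal length, so the length is paired
  in as well. Thus an injection exists and the choice in \<open>tup\<close> is one.\<close>

lemma inj_tup:
  assumes "infinite (UNIV :: 'u set)"
  shows "inj (tup :: 'u list \<Rightarrow> 'u)"
proof -
  have "\<exists>f. inj_on f ((UNIV :: 'u set) \<times> (UNIV :: 'u set)) \<and> f ` (UNIV \<times> UNIV) \<subseteq> (UNIV :: 'u set)"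
    unfolding card_of_ordLeq by (rule ordIso_imp_ordLeq[OF card_of_Times_same_infinite[OF assms]])
  then obtain pr :: "'u \<times> 'u \<Rightarrow> 'u" where pr: "inj pr" by auto
  obtain z :: "nat \<Rightarrow> 'u" where z: "inj z"
    using infinite_countable_subset[OF assms] by auto
  define code where "code xs = foldr (\<lambda>x c. pr (x, c)) xs (z 0)" for xs
  have code: "xs = ys" if "length xs = length ys" "code xs = code ys" for xs ys
    using that by (induction xs ys rule: list_induct2) (auto simp: code_def dest: injD[OF pr])
  have "inj (\<lambda>xs. pr (z (length xs), code xs))"
    using code by (auto intro!: injI dest!: injD[OF pr] injD[OF z])
  then show ?thesis unfolding tup_def by (rule someI[where P = inj])
qed

lemma universe_infinite: "universe (U :: 'u set \<Rightarrow> bool) \<Longrightarrow> infinite (UNIV :: 'u set)"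
  unfolding universe_def by (meson infinite_super subset_UNIV)

lemma num_eq_iff:
  assumes "infinite (UNIV :: 'u set)"
  shows "(num i :: 'u) = num j \<longleftrightarrow> i = j"
  using inj_tup[OF assms] by (auto simp: num_def inj_eq)

text \<open>Sets are the graphs enriched in the one-object category with object \<open>void\<close>, so the base case of
  globular sets is covered by the results on graphs. The chosen coproducts agree only on families of
  objects, see \<open>Cop_Inj_Sets\<close>.\<close>

definition point_cat :: "'u gcat" where
  "point_cat = \<lparr> Obj = {void}, Arr = {void_map}, Dom = dm, Cod = cd, Id = (\<lambda>_. void_map),
     Cmp = (\<lambda>_ _. void_map), Prd = (\<lambda>_. void), Prj = (\<lambda>_ _. void_map), Cop = (\<lambda>_ _. void),
     Inj = (\<lambda>_ _ _. void_map) \<rparr>"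

lemma point_cat_simps [simp]:
  "Obj point_cat = {void}" "Arr point_cat = {void_map}" "Dom point_cat = dm" "Cod point_cat = cd" "Id point_cat X = void_map"
  "Cmp point_cat g f = void_map"
  "f \<in> Hom point_cat X Y \<longleftrightarrow> f = void_map \<and> X = void \<and> Y = void"
  by (auto simp: point_cat_def Hom_def)

interpretation point_cat: gcategory point_cat
  by unfold_locales simp_all

text \<open>A graph over \<open>point_cat\<close> has hom \<open>void\<close> between any two
  elements, objects or not, and likewise for the hom maps of a morphism; this is how discrete sets
  are encoded.\<close>

lemma Sets_Graphs:
  "Obj (Sets U) = Obj (Graphs U point_cat)" (is ?O)
  "Arr (Sets U) = Arr (Graphs U point_cat)"
  "Dom (Sets U) = Dom (Graphs U point_cat)"
  "Cod (Sets U) = Cod (Graphs U point_cat)"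
  "Id (Sets U) = Id (Graphs U point_cat)"
  "Cmp (Sets U) = Cmp (Graphs U point_cat)"
proof -
  show O: ?O by (auto simp: fun_eq_iff)
  show "Arr (Sets U) = Arr (Graphs U point_cat)"
  proof (intro set_eqI)
    fix f :: "'a gmap"
    have "f \<in> Arr (Sets U) \<longleftrightarrow> dm f \<in> Obj (Sets U) \<and> cd f \<in> Obj (Sets U) \<and>
        obm f \<in> ob (dm f) \<rightarrow>\<^sub>E ob (cd f) \<and> hmm f = (\<lambda>_ _. void_map)"
      by (simp add: Sets_def Let_def)
    also have "\<dots> \<longleftrightarrow> f \<in> Hom (Graphs U point_cat) (dm f) (cd f)"
      unfolding Hom_Graphs_iff O by (auto simp: fun_eq_iff)
    finally show "f \<in> Arr (Sets U) \<longleftrightarrow> f \<in> Arr (Graphs U point_cat)"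
      by (simp add: Hom_def)
  qed
qed (simp_all add: Sets_def Graphs_def Let_def mk_map_def fun_eq_iff)

lemma Hom_cong: "Arr C = Arr D \<Longrightarrow> Dom C = Dom D \<Longrightarrow> Cod C = Cod D \<Longrightarrow> Hom C = Hom D"
  by (simp add: Hom_def fun_eq_iff)

lemma Hom_Sets: "Hom (Sets U) = Hom (Graphs U point_cat)"
  by (rule Hom_cong) (rule Sets_Graphs)+

text \<open>The axioms of \<open>gcategory\<close> speak only of the fields on which
  \<open>Sets U\<close> and \<open>Graphs U point_cat\<close> agree.\<close>

lemma gcategory_Sets:
  assumes "U {}"
  shows "gcategory (Sets U)"
  using point_cat.gcategory_Graphs[of U, OF assms] unfolding gcategory_def Hom_Sets Sets_Graphs .

lemma gcategory_Glob_fin: "U {} \<Longrightarrow> gcategory (Glob_fin U n)"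
  by (induction n) (simp_all add: gcategory_Sets gcategory.gcategory_Graphs)

section \<open>Globular sets as a category\<close>

lemma Obj_lim_iff: "X \<in> Obj (Glob_lim U) \<longleftrightarrow> (\<forall>n. trunc n X \<in> Obj (Glob_fin U n))"
  by (simp add: Glob_lim_def)

text \<open>A coinduction principle for being an arrow: since \<open>R\<close> is closed under
  passing to homs, induction on \<open>n\<close> over all related triples shows every
  \<open>n\<close>-truncation to be an arrow.\<close>

lemma Hom_lim_coinduct:
  assumes "R f X Y"
    and step: "\<And>f X Y. R f X Y \<Longrightarrow> X \<in> Obj (Glob_lim U) \<and> Y \<in> Obj (Glob_lim U) \<and>
      dm f = X \<and> cd f = Y \<and> obm f \<in> ob X \<rightarrow>\<^sub>E ob Y \<and>
      (\<forall>a b. if a \<in> ob X \<and> b \<in> ob X then R (hmm f a b) (hm X a b) (hm Y (obm f a) (obm f b))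
        else hmm f a b = void_map)"
  shows "f \<in> Hom (Glob_lim U) X Y"
proof -
  have "trunc_map n f \<in> Hom (Glob_fin U n) (trunc n X) (trunc n Y)" if "R f X Y" for n
    using that
  proof (induction n arbitrary: f X Y)
    case 0
    then have "trunc 0 X \<in> Obj (Glob_fin U 0)" "trunc 0 Y \<in> Obj (Glob_fin U 0)" "obm f \<in> ob X \<rightarrow>\<^sub>E ob Y"
      "dm f = X" "cd f = Y"
      using step[OF 0] unfolding Obj_lim_iff by (blast, blast, simp_all)
    then show ?case by (auto simp: Hom_def Sets_def Let_def)
  next
    case (Suc n)
    note * = step[OF Suc.prems]
    then have "trunc (Suc n) X \<in> Obj (Glob_fin U (Suc n))" "trunc (Suc n) Y \<in> Obj (Glob_fin U (Suc n))"
      unfolding Obj_lim_iff by blast+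
    moreover have "if a \<in> ob X \<and> b \<in> ob X
        then trunc_map n (hmm f a b) \<in> Hom (Glob_fin U n) (trunc n (hm X a b)) (trunc n (hm Y (obm f a) (obm f b)))
        else trunc_map n (hmm f a b) = void_map" for a b
    proof (cases "a \<in> ob X \<and> b \<in> ob X")
      case True
      then have "R (hmm f a b) (hm X a b) (hm Y (obm f a) (obm f b))" using * by presburger
      with True show ?thesis using Suc.IH by simp
    next
      case False
      then have "hmm f a b = void_map" using * by presburger
      then show ?thesis unfolding if_not_P[OF False] by simp
    qed
    ultimately show ?case
      unfolding Glob_fin.simps Hom_Graphs_iff using * by (simp del: Graphs_simps)
  qed
  from this[OF assms(1)] step[OF assms(1)] have "\<forall>n. trunc_map n f \<in> Arr (Glob_fin U n)" "dm f = X" "cd f = Y"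
    by (simp_all add: Hom_def)
  then show ?thesis by (simp add: Hom_def) (simp add: Glob_lim_def)
qed

text \<open>As \<open>Glob_lim U\<close> equals its own category of graphs, facts about graphs
  specialise to it by rewriting with \<open>Graphs_Glob_lim\<close>; identities and composites are
  treated in the same way below.\<close>

lemmas Hom_limD = Hom_GraphsD[where U = U and V = "Glob_lim U" for U, unfolded Graphs_Glob_lim]

lemma lim_Id_sel: 
  "dm (Id (Glob_lim U) X) = X" "cd (Id (Glob_lim U) X) = X"
  "obm (Id (Glob_lim U) X) = restrict (\<lambda>x. x) (ob X)"
  "hmm (Id (Glob_lim U) X) a b = (if a \<in> ob X \<and> b \<in> ob X then Id (Glob_lim U) (hm X a b) else void_map)"
  by (subst Graphs_Id[of U "Glob_lim U" X, unfolded Graphs_Glob_lim], simp)+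

lemma lim_Cmp_sel: 
  "dm (Cmp (Glob_lim U) g f) = dm f" "cd (Cmp (Glob_lim U) g f) = cd g"
  "obm (Cmp (Glob_lim U) g f) = restrict (\<lambda>x. obm g (obm f x)) (ob (dm f))"
  "hmm (Cmp (Glob_lim U) g f) a b = (if a \<in> ob (dm f) \<and> b \<in> ob (dm f) then
     hmm g (obm f a) (obm f b) \<cdot>\<^bsub>Glob_lim U\<^esub> hmm f a b else void_map)"
  by (subst Graphs_Cmp[of U "Glob_lim U" g f, unfolded Graphs_Glob_lim], simp)+

text \<open>Bisimulation up to equality. The alternative of equality takes care of pairs
  \<open>a\<close>, \<open>b\<close> that are not both objects, where the hom maps are
  \<open>void_map\<close> on either side.\<close>

lemma gmap_coinduct:
  assumes "R f g"
    and "\<And>f g. R f g \<Longrightarrow> dm f = dm g \<and> cd f = cd g \<and> obm f = obm g \<and>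
      (\<forall>a b. R (hmm f a b) (hmm g a b) \<or> hmm f a b = hmm g a b)"
  shows "f = g"
  by (rule gmap.coinduct_strong[of R, OF assms(1)]) (use assms(2) in \<open>simp add: rel_fun_def\<close>)

text \<open>Deducing this from \<open>gcategory_Graphs\<close> would be circular, because
  \<open>Glob_lim U\<close> is its own category of graphs. Identities, composites and the category
  laws are therefore treated by coinduction, each step being the computation for graphs. Initiality
  of \<open>void\<close> is settled by one unfolding, as \<open>void\<close> has no objects.\<close>

lemma gcategory_Glob_lim:
  assumes "U {}"
  shows "gcategory (Glob_lim U)"
proof
  let ?L = "Glob_lim U"
  show "Dom ?L = dm" "Cod ?L = cd" by simp_all
  show "dm f \<in> Obj ?L \<and> cd f \<in> Obj ?L" if "f \<in> Arr ?L" for f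
    using Hom_limD(1,2)[where f = f and X = "dm f" and Y = "cd f" and U = U] that
    by (simp only: Hom_def Glob_lim_Dom mem_Collect_eq simp_thms)
  have hmO: "hm X a b \<in> Obj ?L" if "X \<in> Obj ?L" "a \<in> ob X" "b \<in> ob X" for X a b
    using Obj_Graphs_hm[of X U ?L, unfolded Graphs_Glob_lim] that by blast
  show "Id ?L X \<in> Hom ?L X X" if "X \<in> Obj ?L" for X
    by (rule Hom_lim_coinduct[where R = "\<lambda>f X Y. X \<in> Obj ?L \<and> Y = X \<and> f = Id ?L X"])
      (auto simp: that lim_Id_sel hmO)
  show C: "g \<cdot>\<^bsub>?L\<^esub> f \<in> Hom ?L X Z" if "f \<in> Hom ?L X Y" "g \<in> Hom ?L Y Z" for f g X Y Z
  \<comment> \<open>The invariant is to be a composite of two arrows: each hom map of a composite is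
    again such a composite.\<close>
  proof (rule Hom_lim_coinduct[where R = "\<lambda>h X Z. \<exists>f g Y. f \<in> Hom ?L X Y \<and> g \<in> Hom ?L Y Z \<and> h = g \<cdot>\<^bsub>?L\<^esub> f"])
    fix h X Z
    assume "\<exists>f g Y. f \<in> Hom ?L X Y \<and> g \<in> Hom ?L Y Z \<and> h = g \<cdot>\<^bsub>?L\<^esub> f"
    then obtain f g Y where fg: "f \<in> Hom ?L X Y" "g \<in> Hom ?L Y Z" and h: "h = g \<cdot>\<^bsub>?L\<^esub> f" by blast
    note f = Hom_limD[OF fg(1)] and g = Hom_limD[OF fg(2)]
    have "obm h \<in> ob X \<rightarrow>\<^sub>E ob Z" using f(3,5) g(5) by (auto simp: h lim_Cmp_sel)
    moreover have "if a \<in> ob X \<and> b \<in> ob X then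
        \<exists>f' g' Y'. f' \<in> Hom ?L (hm X a b) Y' \<and> g' \<in> Hom ?L Y' (hm Z (obm h a) (obm h b)) \<and> hmm h a b = g' \<cdot>\<^bsub>?L\<^esub> f'
        else hmm h a b = void_map" for a b
      using f(3,5) f(6)[of a b] g(6)[of "obm f a" "obm f b"] by (auto simp: h lim_Cmp_sel)
    moreover have "dm h = X" "cd h = Z" using f(3) g(4) by (simp_all add: h lim_Cmp_sel(1,2))
    ultimately show "X \<in> Obj ?L \<and> Z \<in> Obj ?L \<and> dm h = X \<and> cd h = Z \<and> obm h \<in> ob X \<rightarrow>\<^sub>E ob Z \<and>
      (\<forall>a b. if a \<in> ob X \<and> b \<in> ob X then
        \<exists>f' g' Y'. f' \<in> Hom ?L (hm X a b) Y' \<and> g' \<in> Hom ?L Y' (hm Z (obm h a) (obm h b)) \<and> hmm h a b = g' \<cdot>\<^bsub>?L\<^esub> f'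
        else hmm h a b = void_map)"
      using f(1) g(2) by blast
  qed (use that in blast)
  have obm_ext: "obm f = restrict (\<lambda>x. obm f x) (ob X)" if "f \<in> Hom ?L X Y" for f X Y
  proof (rule PiE_restrict[symmetric])
    show "obm f \<in> ob X \<rightarrow>\<^sub>E ob Y"
      using that Hom_Graphs_iff[of f U ?L X Y] unfolding Graphs_Glob_lim by blast
  qed
  show "Id ?L Y \<cdot>\<^bsub>?L\<^esub> f = f" if f: "f \<in> Hom ?L X Y" for f X Y
  proof (rule gmap_coinduct[where R = "\<lambda>g f. \<exists>X Y. f \<in> Hom ?L X Y \<and> g = Id ?L Y \<cdot>\<^bsub>?L\<^esub> f"])
    fix g f assume "\<exists>X Y. f \<in> Hom ?L X Y \<and> g = Id ?L Y \<cdot>\<^bsub>?L\<^esub> f"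
    then obtain X Y where f: "f \<in> Hom ?L X Y" and g: "g = Id ?L Y \<cdot>\<^bsub>?L\<^esub> f" by blast
    note f' = Hom_limD[OF f]
    have "obm g = obm f" 
      by (subst obm_ext[OF f]) (use f'(3,5) in \<open>auto simp: g lim_Cmp_sel lim_Id_sel\<close>)
    moreover have "(\<exists>X Y. hmm f a b \<in> Hom ?L X Y \<and> hmm g a b = Id ?L Y \<cdot>\<^bsub>?L\<^esub> hmm f a b) \<or> hmm g a b = hmm f a b" for a b
      using f'(3,5) f'(6)[of a b] f'(7)[of a b] by (auto simp: g lim_Cmp_sel lim_Id_sel)
    ultimately show "dm g = dm f \<and> cd g = cd f \<and> obm g = obm f \<and>
      (\<forall>a b. (\<exists>X Y. hmm f a b \<in> Hom ?L X Y \<and> hmm g a b = Id ?L Y \<cdot>\<^bsub>?L\<^esub> hmm f a b) \<or> hmm g a b = hmm f a b)"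
      using f'(4) by (simp add: g lim_Cmp_sel(1,2) lim_Id_sel(2))
  qed (use f in blast)
  show "f \<cdot>\<^bsub>?L\<^esub> Id ?L X = f" if f: "f \<in> Hom ?L X Y" for f X Y
  proof (rule gmap_coinduct[where R = "\<lambda>g f. \<exists>X Y. f \<in> Hom ?L X Y \<and> g = f \<cdot>\<^bsub>?L\<^esub> Id ?L X"])
    fix g f assume "\<exists>X Y. f \<in> Hom ?L X Y \<and> g = f \<cdot>\<^bsub>?L\<^esub> Id ?L X"
    then obtain X Y where f: "f \<in> Hom ?L X Y" and g: "g = f \<cdot>\<^bsub>?L\<^esub> Id ?L X" by blast
    note f' = Hom_limD[OF f]
    have "obm g = obm f" 
      by (subst obm_ext[OF f]) (auto simp: g lim_Cmp_sel lim_Id_sel)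
    moreover have "(\<exists>X Y. hmm f a b \<in> Hom ?L X Y \<and> hmm g a b = hmm f a b \<cdot>\<^bsub>?L\<^esub> Id ?L X) \<or> hmm g a b = hmm f a b" for a b
      using f'(6)[of a b] f'(7)[of a b] by (auto simp: g lim_Cmp_sel lim_Id_sel)
    ultimately show "dm g = dm f \<and> cd g = cd f \<and> obm g = obm f \<and>
      (\<forall>a b. (\<exists>X Y. hmm f a b \<in> Hom ?L X Y \<and> hmm g a b = hmm f a b \<cdot>\<^bsub>?L\<^esub> Id ?L X) \<or> hmm g a b = hmm f a b)"
      using f'(3) by (simp add: g lim_Cmp_sel(1,2) lim_Id_sel(1))
  qed (use f in blast)
  show "h \<cdot>\<^bsub>?L\<^esub> (g \<cdot>\<^bsub>?L\<^esub> f) = h \<cdot>\<^bsub>?L\<^esub> g \<cdot>\<^bsub>?L\<^esub> f"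
    if "f \<in> Hom ?L X Y" "g \<in> Hom ?L Y Z" "h \<in> Hom ?L Z W" for f g h X Y Z W
  proof (rule gmap_coinduct[where R = "\<lambda>k l. \<exists>f g h X Y Z W. f \<in> Hom ?L X Y \<and> g \<in> Hom ?L Y Z \<and>
      h \<in> Hom ?L Z W \<and> k = h \<cdot>\<^bsub>?L\<^esub> (g \<cdot>\<^bsub>?L\<^esub> f) \<and> l = h \<cdot>\<^bsub>?L\<^esub> g \<cdot>\<^bsub>?L\<^esub> f"])
    let ?R = "\<lambda>k l. \<exists>f g h X Y Z W. f \<in> Hom ?L X Y \<and> g \<in> Hom ?L Y Z \<and>
      h \<in> Hom ?L Z W \<and> k = h \<cdot>\<^bsub>?L\<^esub> (g \<cdot>\<^bsub>?L\<^esub> f) \<and> l = h \<cdot>\<^bsub>?L\<^esub> g \<cdot>\<^bsub>?L\<^esub> f"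
    fix k l assume "?R k l"
    then obtain f g h X Y Z W where fgh: "f \<in> Hom ?L X Y" "g \<in> Hom ?L Y Z" "h \<in> Hom ?L Z W"
      and kl: "k = h \<cdot>\<^bsub>?L\<^esub> (g \<cdot>\<^bsub>?L\<^esub> f)" "l = h \<cdot>\<^bsub>?L\<^esub> g \<cdot>\<^bsub>?L\<^esub> f" by blast
    note f = Hom_limD[OF fgh(1)] and g = Hom_limD[OF fgh(2)] and h = Hom_limD[OF fgh(3)]
    have "obm k = obm l" using f(3,5) g(3) by (auto simp: kl lim_Cmp_sel)
    moreover have "?R (hmm k a b) (hmm l a b) \<or> hmm k a b = hmm l a b" for a b
    proof (cases "a \<in> ob X \<and> b \<in> ob X")
      case True
      then have "hmm k a b = hmm h (obm g (obm f a)) (obm g (obm f b)) \<cdot>\<^bsub>?L\<^esub> (hmm g (obm f a) (obm f b) \<cdot>\<^bsub>?L\<^esub> hmm f a b)"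
        "hmm l a b = hmm h (obm g (obm f a)) (obm g (obm f b)) \<cdot>\<^bsub>?L\<^esub> hmm g (obm f a) (obm f b) \<cdot>\<^bsub>?L\<^esub> hmm f a b"
        using f(3,5) g(3) by (auto simp: kl lim_Cmp_sel)
      moreover have "hmm f a b \<in> Hom ?L (hm X a b) (hm Y (obm f a) (obm f b))"
        "hmm g (obm f a) (obm f b) \<in> Hom ?L (hm Y (obm f a) (obm f b)) (hm Z (obm g (obm f a)) (obm g (obm f b)))"
        "hmm h (obm g (obm f a)) (obm g (obm f b)) \<in> Hom ?L (hm Z (obm g (obm f a)) (obm g (obm f b)))
          (hm W (obm h (obm g (obm f a))) (obm h (obm g (obm f b))))"
        using True f(5) g(5) by (auto intro: f(6) g(6) h(6))
      ultimately show ?thesis by (intro disjI1 exI conjI)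
    next
      case False
      then show ?thesis using f(3) by (auto simp: kl lim_Cmp_sel)
    qed
    moreover have "dm k = dm l" "cd k = cd l" by (simp_all add: kl lim_Cmp_sel(1,2))
    ultimately show "dm k = dm l \<and> cd k = cd l \<and> obm k = obm l \<and>
      (\<forall>a b. ?R (hmm k a b) (hmm l a b) \<or> hmm k a b = hmm l a b)"
      by (intro conjI allI)
  qed (intro exI conjI, rule that(1), rule that(2), rule that(3), rule refl, rule refl)
  show v: "void \<in> Obj ?L" using assms unfolding Obj_lim by simp
  have e: "Gmap void X (\<lambda>_. undefined) (\<lambda>_ _. void_map) \<in> Hom ?L void X" if "X \<in> Obj ?L" for X
    using Hom_Graphs_iff[where f = "Gmap void X (\<lambda>_. undefined) (\<lambda>_ _. void_map)" and U = U and V = ?L]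
      that v unfolding Graphs_Glob_lim by simp
  show "void_map \<in> Hom ?L void void" using e[OF v] by (simp add: Gmap_void)
  show "\<exists>f. f \<in> Hom ?L void X" if "X \<in> Obj ?L" for X using e[OF that] by blast
  show "f = g" if "f \<in> Hom ?L void X" "g \<in> Hom ?L void X" for f g X
    by (rule Hom_Graphs_eqI[where V = ?L and U = U, unfolded Graphs_Glob_lim, OF that]) auto
qed

lemma gcategory_Glob: "U {} \<Longrightarrow> gcategory (Glob U n)"
  by (cases n) (simp_all add: Glob_def gcategory_Glob_fin gcategory_Glob_lim)

section \<open>Lifting properties of morphisms of graphs\<close>

text \<open>Used in two ways: with \<open>V = Glob U m\<close>, where \<open>G\<close> is
  \<open>Glob U (m + 1)\<close>, and with \<open>V = point_cat\<close>, where \<open>G\<close> has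
  the objects, arrows and composition of \<open>Sets U\<close>.\<close>

locale graphs = gcategory V for V :: "'u gcat" +
  fixes U :: "'u set \<Rightarrow> bool"
  assumes U: "universe U"
begin

abbreviation G where "G \<equiv> Graphs U V"

lemma U_finite: "finite A \<Longrightarrow> U A"
  using universe_finite[OF U] .

sublocale G: gcategory "Graphs U V"
  by (rule gcategory_Graphs) (simp add: U_finite)

lemma num_eq [simp]: "(num i :: 'u) = num j \<longleftrightarrow> i = j"
  by (rule num_eq_iff[OF universe_infinite[OF U]])

section \<open>The graph of a sequence and the morphisms out of it\<close>

lemma seq_graph_sel:
  fixes Zs :: "'u gset list"
  shows
  "ob (seq_graph Zs) = num ` {0..length Zs}"
  "j < length Zs \<Longrightarrow> hm (seq_graph Zs) (num j) (num (Suc j)) = Zs ! j"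
  "hm (seq_graph Zs) a b = void \<or> (\<exists>j<length Zs. hm (seq_graph Zs) a b = Zs ! j)"
proof -
  show "ob (seq_graph Zs) = num ` {0..length Zs}" by (simp add: seq_graph_def mk_graph_def)
  have the: "(THE i. i < length Zs \<and> num j = (num i :: 'u)) = j" if "j < length Zs" for j
    using that by (intro the_equality) auto
  show "hm (seq_graph Zs) (num j) (num (Suc j)) = Zs ! j" if "j < length Zs"
    using that the[OF that] by (auto simp: seq_graph_def mk_graph_def)
  show "hm (seq_graph Zs) a b = void \<or> (\<exists>j<length Zs. hm (seq_graph Zs) a b = Zs ! j)"
    using the by (auto simp: seq_graph_def mk_graph_def)
qed

lemma seq_graph_Obj: "set Zs \<subseteq> Obj V \<Longrightarrow> seq_graph Zs \<in> Obj G"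
proof -
  assume Zs: "set Zs \<subseteq> Obj V"
  have "hm (seq_graph Zs) a b \<in> Obj V" for a b
    using seq_graph_sel(3)[of Zs a b] Zs void_Obj nth_mem by fastforce
  moreover have "hm (seq_graph Zs) a b = void" if "\<not> (a \<in> ob (seq_graph Zs) \<and> b \<in> ob (seq_graph Zs))" for a b
    using that by (auto simp: seq_graph_def mk_graph_def)
  ultimately show ?thesis by (simp add: U_finite seq_graph_sel(1))
qed

lemma ob_seq1: "ob (seq_graph [Z :: 'u gset]) = {num 0, num (Suc 0)}"
proof -
  have "{0..length [Z]} = {0, 1}" by auto
  then show ?thesis unfolding seq_graph_sel(1) by simp
qed

lemma hm_seq1:
  "hm (seq_graph [Z :: 'u gset]) a b = (if a = num 0 \<and> b = num (Suc 0) then Z else void)"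
  using seq_graph_sel(2)[of 0 "[Z]"] by (auto simp: seq_graph_def mk_graph_def)

text \<open>The morphism \<open>(S) \<rightarrow> X\<close> that corresponds to \<open>a\<close>, \<open>b\<close> and \<open>u : S \<rightarrow> X(a,b)\<close>.\<close>

definition seq_to :: "'u gset \<Rightarrow> 'u \<Rightarrow> 'u \<Rightarrow> 'u gmap \<Rightarrow> 'u gmap" where
  "seq_to X a b u = mk_map (seq_graph [dm u]) X (\<lambda>x. if x = num 0 then a else b)
     (\<lambda>x y. if x = num 0 \<and> y = num (Suc 0) then u
        else from_void (hm X (if x = num 0 then a else b) (if y = num 0 then a else b)))"

lemma seq_to_sel:
  "obm (seq_to X a b u) (num 0) = a" "obm (seq_to X a b u) (num (Suc 0)) = b"
  "hmm (seq_to X a b u) (num 0) (num (Suc 0)) = u"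
  by (simp_all add: seq_to_def ob_seq1)

lemma seq_to_Hom:
  assumes X: "X \<in> Obj G" "a \<in> ob X" "b \<in> ob X" and u: "u \<in> Hom V S (hm X a b)"
  shows "seq_to X a b u \<in> Hom G (seq_graph [S]) X"
proof -
  have S: "dm u = S" "S \<in> Obj V" using u Hom_Obj by (auto simp: Hom_iff)
  show ?thesis
    unfolding seq_to_def S(1)
  proof (rule Hom_GraphsI)
    show "seq_graph [S] \<in> Obj G" using seq_graph_Obj[of "[S]"] S by simp
    show "X \<in> Obj G" by (rule X(1))
  qed (use X u in \<open>auto simp: hm_seq1 ob_seq1 intro!: from_void_Hom Obj_Graphs_hm[OF X(1)]\<close>)
qed

text \<open>Apart from the hom from \<open>num 0\<close> to \<open>num 1\<close>, all homs of
  \<open>(S)\<close> are \<open>void\<close>, and maps out of \<open>void\<close> with equal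
  codomain coincide.\<close>

lemma seq_Hom_eqI:
  assumes "f \<in> Hom G (seq_graph [S]) X" "g \<in> Hom G (seq_graph [S]) X"
    and "obm f (num 0) = obm g (num 0)" "obm f (num (Suc 0)) = obm g (num (Suc 0))"
    and "hmm f (num 0) (num (Suc 0)) = hmm g (num 0) (num (Suc 0))"
  shows "f = g"
proof (rule Hom_Graphs_eqI[OF assms(1,2)])
  note f = Hom_GraphsD[OF assms(1)] and g = Hom_GraphsD[OF assms(2)]
  show ob: "obm f x = obm g x" if "x \<in> ob (seq_graph [S])" for x
    using that assms by (auto simp: ob_seq1)
  show "hmm f a b = hmm g a b" if ab: "a \<in> ob (seq_graph [S])" "b \<in> ob (seq_graph [S])" for a b
  proof (cases "a = num 0 \<and> b = num (Suc 0)")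
    case False
    then have "hm (seq_graph [S]) a b = void" by (auto simp: hm_seq1)
    then show ?thesis
      using f(6)[OF ab] g(6)[OF ab] unfolding ob[OF ab(1)] ob[OF ab(2)] by (auto intro: void_Hom_unique)
  qed (use assms in simp)
qed

lemma seq_Hom_Hom: 
  assumes "f \<in> Hom G (seq_graph [S]) X"
  shows "obm f (num 0) \<in> ob X" "obm f (num (Suc 0)) \<in> ob X"
    "hmm f (num 0) (num (Suc 0)) \<in> Hom V S (hm X (obm f (num 0)) (obm f (num (Suc 0))))"
  using Hom_GraphsD(5)[OF assms] Hom_GraphsD(6)[OF assms, of "num 0" "num (Suc 0)"] by (simp_all add: ob_seq1 hm_seq1)

lemma seq_map_Hom:
  assumes "j \<in> Hom V S B"
  shows "seq_map j \<in> Hom G (seq_graph [S]) (seq_graph [B])"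
proof -
  have j: "dm j = S" "cd j = B" "S \<in> Obj V" "B \<in> Obj V" using assms Hom_Obj by (auto simp: Hom_iff)
  show ?thesis
    unfolding seq_map_def j(1,2)
    by (rule Hom_GraphsI)
      (use j assms void_map_Hom seq_graph_Obj in \<open>auto simp: ob_seq1 hm_seq1 simp del: Graphs_simps\<close>)
qed

lemma seq_map_sel:
  fixes j :: "'u gmap"
  shows "dm (seq_map j) = seq_graph [dm j]" "cd (seq_map j) = seq_graph [cd j]"
  "x \<in> {num 0, num (Suc 0)} \<Longrightarrow> obm (seq_map j) x = x"
  "hmm (seq_map j) (num 0) (num (Suc 0)) = j"
  by (auto simp: seq_map_def ob_seq1)

lemma G_Cmp_sel:
  assumes "f \<in> Hom G X Y"
  shows "x \<in> ob X \<Longrightarrow> obm (g \<cdot>\<^bsub>G\<^esub> f) x = obm g (obm f x)"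
    "a \<in> ob X \<Longrightarrow> b \<in> ob X \<Longrightarrow> hmm (g \<cdot>\<^bsub>G\<^esub> f) a b = hmm g (obm f a) (obm f b) \<cdot>\<^bsub>V\<^esub> hmm f a b"
  using Hom_GraphsD(3)[OF assms] by (simp_all add: Graphs_Cmp)

section \<open>Lifting against the members of \<open>plus_class\<close>\<close>

lemma has_rlp_seq_map:
  assumes f: "f \<in> Hom G X Y" "identity_on_objects f" and j: "j \<in> Arr V"
  shows "has_rlp G f (seq_map j) \<longleftrightarrow> (\<forall>a\<in>ob X. \<forall>b\<in>ob X. has_rlp V (hmm f a b) j)"
proof -
  define S B where SB: "S = dm j" "B = cd j"
  have jj: "j \<in> Hom V S B" using Hom_self[OF j] by (simp add: SB)
  note J = seq_map_Hom[OF jj]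
  note F = Hom_GraphsD[OF f(1)]
  have id: "ob Y = ob X" "\<And>x. x \<in> ob X \<Longrightarrow> obm f x = x"
    using f(2) F(3,4) by (auto simp: identity_on_objects_def)
  have hm: "hmm f a b \<in> Hom V (hm X a b) (hm Y a b)" if "a \<in> ob X" "b \<in> ob X" for a b
    using F(6)[OF that] that id by simp
  have dc: "dm (hmm f a b) = hm X a b" "cd (hmm f a b) = hm Y a b" if "a \<in> ob X" "b \<in> ob X" for a b
    using hm[OF that] by (auto simp: Hom_iff)
  have c01: "num 0 \<in> ob (seq_graph [Z])" "num (Suc 0) \<in> ob (seq_graph [Z])" for Z :: "'u gset"
    by (simp_all add: ob_seq1)
  note CS = G_Cmp_sel(1)[OF _ c01(1)] G_Cmp_sel(1)[OF _ c01(2)] G_Cmp_sel(2)[OF _ c01(1) c01(2)]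
  show ?thesis
  proof (intro iffI ballI)
    fix a b assume rlp: "has_rlp G f (seq_map j)" and ab: "a \<in> ob X" "b \<in> ob X"
    have abY: "a \<in> ob Y" "b \<in> ob Y" using ab id by auto
    show "has_rlp V (hmm f a b) j"
      unfolding has_rlp_iff dc[OF ab] SB[symmetric]
    proof (intro ballI impI)
      fix u v assume u: "u \<in> Hom V S (hm X a b)" and v: "v \<in> Hom V B (hm Y a b)"
        and sq: "hmm f a b \<cdot>\<^bsub>V\<^esub> u = v \<cdot>\<^bsub>V\<^esub> j"
      note u' = seq_to_Hom[OF F(1) ab u] and v' = seq_to_Hom[OF F(2) abY v]
      have "f \<cdot>\<^bsub>G\<^esub> seq_to X a b u = seq_to Y a b v \<cdot>\<^bsub>G\<^esub> seq_map j"
        by (rule seq_Hom_eqI[OF G.Cmp_Hom[OF u' f(1)] G.Cmp_Hom[OF J v']])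
          (use ab id sq in \<open>simp_all add: CS[OF u'] CS[OF J] seq_to_sel seq_map_sel\<close>)
      then obtain d where d: "d \<in> Hom G (seq_graph [B]) X" "d \<cdot>\<^bsub>G\<^esub> seq_map j = seq_to X a b u"
        "f \<cdot>\<^bsub>G\<^esub> d = seq_to Y a b v"
        using rlp u' v' unfolding G.has_rlp_iff F(3,4) seq_map_sel(1,2) SB[symmetric] by blast
      \<comment> \<open>The ends of the lift are read off the upper triangle,
        \<open>seq_map j\<close> being the identity on objects.\<close>
      have d01: "obm d (num 0) = a" "obm d (num (Suc 0)) = b"
        using CS(1,2)[OF J, of d] by (simp_all add: d(2) seq_to_sel seq_map_sel)
      show "\<exists>d\<in>Hom V B (hm X a b). d \<cdot>\<^bsub>V\<^esub> j = u \<and> hmm f a b \<cdot>\<^bsub>V\<^esub> d = v"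
      proof (intro bexI conjI)
        show "hmm d (num 0) (num (Suc 0)) \<in> Hom V B (hm X a b)"
          using seq_Hom_Hom(3)[OF d(1)] d01 by simp
        show "hmm d (num 0) (num (Suc 0)) \<cdot>\<^bsub>V\<^esub> j = u"
          using CS(3)[OF J, of d] by (simp add: d(2) seq_to_sel seq_map_sel)
        show "hmm f a b \<cdot>\<^bsub>V\<^esub> hmm d (num 0) (num (Suc 0)) = v"
          using CS(3)[OF d(1), of f] by (simp add: d(3) seq_to_sel d01)
      qed
    qed
  next
    assume rlp: "\<forall>a\<in>ob X. \<forall>b\<in>ob X. has_rlp V (hmm f a b) j"
    show "has_rlp G f (seq_map j)"
      unfolding G.has_rlp_iff F(3,4) seq_map_sel(1,2) SB[symmetric]
    proof (intro ballI impI)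
      fix u v assume u: "u \<in> Hom G (seq_graph [S]) X" and v: "v \<in> Hom G (seq_graph [B]) Y"
        and sq: "f \<cdot>\<^bsub>G\<^esub> u = v \<cdot>\<^bsub>G\<^esub> seq_map j"
      define a b where ab_def: "a = obm u (num 0)" "b = obm u (num (Suc 0))"
      note u' = seq_Hom_Hom[OF u, folded ab_def]
      \<comment> \<open>On objects the square says that \<open>v\<close> has the same two ends as
        \<open>u\<close>; only then is the hom part of \<open>v\<close> a map into
        \<open>hm Y a b\<close>.\<close>
      have v0: "obm v (num 0) = a"
        using arg_cong[OF sq, of "\<lambda>f. obm f (num 0)"] u'(1) by (simp add: CS[OF u] CS[OF J] seq_map_sel ab_def id)
      have v1: "obm v (num (Suc 0)) = b"
        using arg_cong[OF sq, of "\<lambda>f. obm f (num (Suc 0))"] u'(2) by (simp add: CS[OF u] CS[OF J] seq_map_sel ab_def id)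
      note v' = seq_Hom_Hom(3)[OF v, unfolded v0 v1]
      have "hmm f a b \<cdot>\<^bsub>V\<^esub> hmm u (num 0) (num (Suc 0)) = hmm v (num 0) (num (Suc 0)) \<cdot>\<^bsub>V\<^esub> j"
        using arg_cong[OF sq, of "\<lambda>f. hmm f (num 0) (num (Suc 0))"]
        by (simp add: CS[OF u] CS[OF J] seq_map_sel ab_def)
      then obtain d where d: "d \<in> Hom V B (hm X a b)" "d \<cdot>\<^bsub>V\<^esub> j = hmm u (num 0) (num (Suc 0))"
        "hmm f a b \<cdot>\<^bsub>V\<^esub> d = hmm v (num 0) (num (Suc 0))"
        using rlp u' v' unfolding has_rlp_iff SB[symmetric] using dc[OF u'(1,2)] by metis
      note d' = seq_to_Hom[OF F(1) u'(1,2) d(1)]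
      show "\<exists>d\<in>Hom G (seq_graph [B]) X. d \<cdot>\<^bsub>G\<^esub> seq_map j = u \<and> f \<cdot>\<^bsub>G\<^esub> d = v"
      proof (intro bexI conjI)
        show "seq_to X a b d \<in> Hom G (seq_graph [B]) X" by (rule d')
        show "seq_to X a b d \<cdot>\<^bsub>G\<^esub> seq_map j = u"
          by (rule seq_Hom_eqI[OF G.Cmp_Hom[OF J d'] u])
            (use d in \<open>simp_all add: CS[OF J] seq_to_sel seq_map_sel ab_def\<close>)
        show "f \<cdot>\<^bsub>G\<^esub> seq_to X a b d = v"
          by (rule seq_Hom_eqI[OF G.Cmp_Hom[OF d' f(1)] v])
            (use d id u' v0 v1 in \<open>simp_all add: CS[OF d'] seq_to_sel\<close>)
      qed
    qed
  qed
qed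

lemma one_point_Obj: "one_point \<in> Obj G"
  using void_Obj by (simp add: one_point_def U_finite)

lemma empty_to_point_Hom: "empty_to_point \<in> Hom G void one_point"
  unfolding Hom_Graphs_iff using G.void_Obj one_point_Obj
  by (simp add: empty_to_point_def del: Graphs_simps)

text \<open>Morphisms out of \<open>one_point\<close> are choices of an object, and \<open>X\<close>
  and \<open>Y\<close> have the same objects. So the object chosen by \<open>v\<close> defines the
  lift; the upper triangle commutes by initiality of the empty graph, the lower one because the hom
  of \<open>one_point\<close> is initial.\<close>

lemma has_rlp_empty_to_point:
  assumes f: "f \<in> Hom G X Y" "identity_on_objects f"
  shows "has_rlp G f empty_to_point"
proof -
  note F = Hom_GraphsD[OF f(1)]
  have id: "ob Y = ob X" "\<And>x. x \<in> ob X \<Longrightarrow> obm f x = x"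
    using f(2) F(3,4) by (auto simp: identity_on_objects_def)
  have e: "dm empty_to_point = void" "cd empty_to_point = one_point" by (simp_all add: empty_to_point_def)
  have op: "ob one_point = {num 0}" "hm one_point a b = void" for a b by (simp_all add: one_point_def)
  show ?thesis
    unfolding G.has_rlp_iff e F(3,4)
  proof (intro ballI impI)
    fix u v assume u: "u \<in> Hom G void X" and v: "v \<in> Hom G one_point Y"
    define y where "y = obm v (num 0)"
    have y: "y \<in> ob X" using Hom_GraphsD(5)[OF v] id by (simp add: y_def op)
    define d where "d = mk_map one_point X (\<lambda>_. y) (\<lambda>_ _. from_void (hm X y y))"
    have d: "d \<in> Hom G one_point X"
      unfolding d_def by (rule Hom_GraphsI[OF one_point_Obj F(1)])
        (use y in \<open>auto simp: op intro!: from_void_Hom Obj_Graphs_hm[OF F(1)]\<close>)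
    have dy: "obm d (num 0) = y" by (simp add: d_def op)
    show "\<exists>d\<in>Hom G one_point X. d \<cdot>\<^bsub>G\<^esub> empty_to_point = u \<and> f \<cdot>\<^bsub>G\<^esub> d = v"
    proof (intro bexI[OF _ d] conjI)
      show "d \<cdot>\<^bsub>G\<^esub> empty_to_point = u"
        by (rule G.void_Hom_unique[OF G.Cmp_Hom[OF empty_to_point_Hom d] u])
      have fd: "f \<cdot>\<^bsub>G\<^esub> d \<in> Hom G one_point Y" by (rule G.Cmp_Hom[OF d f(1)])
      have ob: "obm (f \<cdot>\<^bsub>G\<^esub> d) (num 0) = obm v (num 0)"
        using G_Cmp_sel(1)[OF d, of "num 0" f] y id by (simp add: op dy y_def)
      show "f \<cdot>\<^bsub>G\<^esub> d = v"
      proof (rule Hom_Graphs_eqI[OF fd v])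
        show "hmm (f \<cdot>\<^bsub>G\<^esub> d) a b = hmm v a b" if "a \<in> ob one_point" "b \<in> ob one_point" for a b
          using Hom_GraphsD(6)[OF fd that] Hom_GraphsD(6)[OF v that] that ob void_Hom_unique
          by (simp add: op)
      qed (use ob in \<open>simp add: op\<close>)
    qed
  qed
qed


subsection \<open>Coproducts of graphs\<close>

lemma inj_tup': "inj (tup :: 'u list \<Rightarrow> 'u)"
  by (rule inj_tup[OF universe_infinite[OF U]])

lemma tag_index_tag [simp]: "tag_index (tag i x :: 'u) = i"
  and tag_elem_tag [simp]: "tag_elem (tag i x :: 'u) = x"
  by (simp_all add: tag_index_def tag_elem_def tag_def untup_def inv_f_f[OF inj_tup'])

lemma tag_eq_iff [simp]: "(tag i x :: 'u) = tag k y \<longleftrightarrow> i = k \<and> x = y"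
  by (metis tag_index_tag tag_elem_tag)

lemma G_Cop_sel:
  fixes F :: "'u list \<Rightarrow> 'u gset"
  shows "ob (Cop G I F) = (\<Union>i\<in>I. tag i ` ob (F i))"
    "i \<in> I \<Longrightarrow> x \<in> ob (F i) \<Longrightarrow> k \<in> I \<Longrightarrow> y \<in> ob (F k) \<Longrightarrow>
      hm (Cop G I F) (tag i x) (tag k y) = (if i = k then hm (F i) x y else void)"
  by (auto simp: Graphs_def Let_def mk_graph_def tagged_def)

lemma G_Inj: "Inj G I F i = mk_map (F i) (Cop G I F) (tag i) (\<lambda>a b. Id V (hm (F i) a b))"
  by (simp add: Graphs_def Let_def)

text \<open>Index sets carry no smallness assumption, so that the coproduct is an object enters as a
  hypothesis. In the application it is a hom of a graph already known to be an object.\<close>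

lemma G_Inj_Hom:
  assumes "Cop G I F \<in> Obj G" "i \<in> I" "F i \<in> Obj G"
  shows "Inj G I F i \<in> Hom G (F i) (Cop G I F)"
  unfolding G_Inj
  by (rule Hom_GraphsI[OF assms(3,1)])
    (use assms(2) in \<open>auto simp: G_Cop_sel intro!: Id_Hom Obj_Graphs_hm[OF assms(3)]\<close>)

lemma G_Inj_Cmp_sel:
  assumes "u \<in> Hom G S (F i)"
  shows "x \<in> ob S \<Longrightarrow> obm (Inj G I F i \<cdot>\<^bsub>G\<^esub> u) x = tag i (obm u x)"
    "a \<in> ob S \<Longrightarrow> b \<in> ob S \<Longrightarrow> hmm (Inj G I F i \<cdot>\<^bsub>G\<^esub> u) a b = hmm u a b"
  using Hom_GraphsD(5)[OF assms] Id_left[OF Hom_GraphsD(6)[OF assms]]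
  by (auto simp: G_Inj G_Cmp_sel[OF assms])

text \<open>Injections are monic: \<open>tag i\<close> is injective on objects, and on homs the
  injection is an identity.\<close>

lemma G_Inj_mono:
  assumes "u \<in> Hom G S (F i)" "v \<in> Hom G S (F i)" "Inj G I F i \<cdot>\<^bsub>G\<^esub> u = Inj G I F i \<cdot>\<^bsub>G\<^esub> v"
  shows "u = v"
proof (rule Hom_Graphs_eqI[OF assms(1,2)])
  show "obm u x = obm v x" if "x \<in> ob S" for x
    using G_Inj_Cmp_sel(1)[where F = F, OF assms(1) that, of I] G_Inj_Cmp_sel(1)[where F = F, OF assms(2) that, of I] assms(3) by simp
  show "hmm u a b = hmm v a b" if "a \<in> ob S" "b \<in> ob S" for a b
    using G_Inj_Cmp_sel(2)[where F = F, OF assms(1) that, of I] G_Inj_Cmp_sel(2)[where F = F, OF assms(2) that, of I] assms(3) by simp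
qed

text \<open>Homs of the coproduct between objects of one summand are the homs of that summand, so
  removing the tags corestricts \<open>u\<close> and leaves its hom maps as they are.\<close>

lemma G_Inj_factor:
  assumes i: "i \<in> I" "F i \<in> Obj G" and u: "u \<in> Hom G S (Cop G I F)"
    and im: "\<And>x. x \<in> ob S \<Longrightarrow> obm u x \<in> tag i ` ob (F i)"
  shows "\<exists>u'\<in>Hom G S (F i). Inj G I F i \<cdot>\<^bsub>G\<^esub> u' = u"
proof -
  note u' = Hom_GraphsD[OF u]
  define w where "w = mk_map S (F i) (\<lambda>x. tag_elem (obm u x)) (hmm u)"
  have el: "tag_elem (obm u x) \<in> ob (F i)" "obm u x = tag i (tag_elem (obm u x))" if "x \<in> ob S" for x
    using im[OF that] by auto
  have w: "w \<in> Hom G S (F i)"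
    unfolding w_def
  proof (rule Hom_GraphsI[OF u'(1) i(2) el(1)])
    show "hmm u a b \<in> Hom V (hm S a b) (hm (F i) (tag_elem (obm u a)) (tag_elem (obm u b)))"
      if "a \<in> ob S" "b \<in> ob S" for a b
      using u'(6)[OF that] G_Cop_sel(2)[where F = F, OF i(1) el(1)[OF that(1)] i(1) el(1)[OF that(2)]]
      by (simp flip: el(2)[OF that(1)] el(2)[OF that(2)])
  qed
  have "Inj G I F i \<cdot>\<^bsub>G\<^esub> w = u"
  proof (rule Hom_Graphs_eqI[OF G.Cmp_Hom[OF w G_Inj_Hom[OF u'(2) i]] u])
    show "obm (Inj G I F i \<cdot>\<^bsub>G\<^esub> w) x = obm u x" if "x \<in> ob S" for x
      using G_Inj_Cmp_sel(1)[where F = F, OF w that, of I] el(2)[OF that] that by (simp add: w_def)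
    show "hmm (Inj G I F i \<cdot>\<^bsub>G\<^esub> w) a b = hmm u a b" if "a \<in> ob S" "b \<in> ob S" for a b
      using G_Inj_Cmp_sel(2)[where F = F, OF w that, of I] that by (simp add: w_def)
  qed
  with w show ?thesis by blast
qed

text \<open>This is what makes the description in \<open>cotuple\<close> meaningful. Within a
  summand \<open>h\<close> is given by \<open>g\<close>; between different summands the homs are
  \<open>void\<close>, where a map exists and is unique.\<close>

lemma G_cotuple_ex1:
  assumes F: "\<And>i. i \<in> I \<Longrightarrow> F i \<in> Obj G" "Cop G I F \<in> Obj G" and Z: "Z \<in> Obj G"
    and g: "\<And>i. i \<in> I \<Longrightarrow> g i \<in> Hom G (F i) Z"
  shows "\<exists>!h. h \<in> Hom G (Cop G I F) Z \<and> (\<forall>i\<in>I. h \<cdot>\<^bsub>G\<^esub> Inj G I F i = g i)"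
proof -
  note g' = Hom_GraphsD[OF g]
  note inj = G_Inj_Hom[OF F(2) _ F(1)]
  define h where "h = mk_map (Cop G I F) Z (\<lambda>c. obm (g (tag_index c)) (tag_elem c))
    (\<lambda>c d. if tag_index c = tag_index d then hmm (g (tag_index c)) (tag_elem c) (tag_elem d)
      else from_void (hm Z (obm (g (tag_index c)) (tag_elem c)) (obm (g (tag_index d)) (tag_elem d))))"
  have h: "h \<in> Hom G (Cop G I F) Z"
    unfolding h_def
    by (rule Hom_GraphsI[OF F(2) Z])
      (use g' in \<open>auto simp: G_Cop_sel intro!: from_void_Hom Obj_Graphs_hm[OF Z]\<close>)
  have h_sel: "obm h (tag i x) = obm (g i) x" "hmm h (tag i x) (tag i y) = hmm (g i) x y"
    if "i \<in> I" "x \<in> ob (F i)" "y \<in> ob (F i)" for i x y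
    using that by (auto simp: h_def G_Cop_sel(1))
  have h_inj: "h \<cdot>\<^bsub>G\<^esub> Inj G I F i = g i" if i: "i \<in> I" for i
  proof (rule Hom_Graphs_eqI[OF G.Cmp_Hom[OF inj[OF i i] h] g[OF i]])
    show "obm (h \<cdot>\<^bsub>G\<^esub> Inj G I F i) x = obm (g i) x" if "x \<in> ob (F i)" for x
      using G_Cmp_sel(1)[OF inj[OF i i] that, of h] h_sel(1)[OF i that that] that by (simp add: G_Inj)
    show "hmm (h \<cdot>\<^bsub>G\<^esub> Inj G I F i) a b = hmm (g i) a b" if "a \<in> ob (F i)" "b \<in> ob (F i)" for a b
      using G_Cmp_sel(2)[OF inj[OF i i] that, of h] h_sel(2)[OF i that] that Id_right[OF g'(6)[OF i that]]
      by (simp add: G_Inj)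
  qed
  show ?thesis
  proof (rule ex1I[of _ h])
    fix k assume "k \<in> Hom G (Cop G I F) Z \<and> (\<forall>i\<in>I. k \<cdot>\<^bsub>G\<^esub> Inj G I F i = g i)"
    then have k: "k \<in> Hom G (Cop G I F) Z" and kg: "\<And>i. i \<in> I \<Longrightarrow> k \<cdot>\<^bsub>G\<^esub> Inj G I F i = h \<cdot>\<^bsub>G\<^esub> Inj G I F i"
      using h_inj by auto
    note k' = Hom_GraphsD[OF k] and h' = Hom_GraphsD[OF h]
    have ob: "obm k (tag i x) = obm h (tag i x)" if "i \<in> I" "x \<in> ob (F i)" for i x
      using G_Cmp_sel(1)[OF inj[OF that(1,1)] that(2), of k]
        G_Cmp_sel(1)[OF inj[OF that(1,1)] that(2), of h] that kg[OF that(1)] by (simp add: G_Inj)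
    show "k = h"
    proof (rule Hom_Graphs_eqI[OF k h])
      show obc: "obm k c = obm h c" if "c \<in> ob (Cop G I F)" for c
        using that ob by (auto simp: G_Cop_sel(1))
      show "hmm k c d = hmm h c d" if cd: "c \<in> ob (Cop G I F)" "d \<in> ob (Cop G I F)" for c d
      proof -
        obtain i x l y where c: "i \<in> I" "x \<in> ob (F i)" "c = tag i x" and d: "l \<in> I" "y \<in> ob (F l)" "d = tag l y"
          using cd by (auto simp: G_Cop_sel(1))
        note kk = k'(6)[OF cd] and hh = h'(6)[OF cd, folded obc[OF cd(1)] obc[OF cd(2)]]
        show ?thesis
        proof (cases "i = l")
          case True
          have hm: "hm (Cop G I F) c d = hm (F i) x y"
            using G_Cop_sel(2)[where F = F, OF c(1,2) d(1,2)] True by (simp add: c d)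
          \<comment> \<open>The injection is an identity on homs, so \<open>k\<close> and
            \<open>h\<close> may be compared after precomposition with it.\<close>
          have "hmm k c d \<cdot>\<^bsub>V\<^esub> Id V (hm (F i) x y) = hmm h c d \<cdot>\<^bsub>V\<^esub> Id V (hm (F i) x y)"
            using G_Cmp_sel(2)[OF inj[OF c(1,1)] c(2), of y k]
              G_Cmp_sel(2)[OF inj[OF c(1,1)] c(2), of y h] d kg[OF c(1)] True c by (simp add: G_Inj)
          then show ?thesis using Id_right[OF kk] Id_right[OF hh] hm by simp
        next
          case False
          have "hm (Cop G I F) c d = void"
            using G_Cop_sel(2)[where F = F, OF c(1,2) d(1,2)] False by (simp add: c d)
          then show ?thesis using kk hh by (auto intro: void_Hom_unique)
        qed
      qed
    qed
  qed (use h h_inj in blast)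
qed

text \<open>\<open>G(B, -)\<close> preserves coproducts; nonemptiness makes the summand unique.\<close>

definition connected :: "'u gset \<Rightarrow> bool" where
  "connected B \<longleftrightarrow> ob B \<noteq> {} \<and>
     (\<forall>I F v. (\<forall>i\<in>I. F i \<in> Obj G) \<longrightarrow> v \<in> Hom G B (Cop G I F) \<longrightarrow>
        (\<exists>i\<in>I. obm v ` ob B \<subseteq> tag i ` ob (F i)))"

lemma connected_one_point: "connected one_point"
  unfolding connected_def
proof (intro conjI allI impI)
  fix I F v assume "v \<in> Hom G one_point (Cop G I F)"
  from Hom_GraphsD(5)[OF this, of "num 0"] show "\<exists>i\<in>I. obm v ` ob one_point \<subseteq> tag i ` ob (F i)"
    by (auto simp: one_point_def G_Cop_sel(1))
qed (simp add: one_point_def)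

lemma Hom_to_void: 
  assumes "f \<in> Hom G X void"
  shows "ob X = {}"
  using Hom_GraphsD(5)[OF assms] by auto


text \<open>If the two objects went to different summands, the hom between their images would be
  \<open>void\<close> and \<open>C\<close> would map to it.\<close>

lemma connected_seq_graph:
  assumes C: "\<And>v. v \<notin> Hom V C void"
  shows "connected (seq_graph [C])"
  unfolding connected_def
proof (intro conjI allI impI)
  fix I F v assume v: "v \<in> Hom G (seq_graph [C]) (Cop G I F)"
  note v' = seq_Hom_Hom[OF v]
  obtain i x k y where i: "i \<in> I" "x \<in> ob (F i)" "obm v (num 0) = tag i x"
    and k: "k \<in> I" "y \<in> ob (F k)" "obm v (num (Suc 0)) = tag k y"
    using v'(1,2) by (auto simp: G_Cop_sel(1))
  have "i = k"
    using v'(3) C G_Cop_sel(2)[where F = F, OF i(1,2) k(1,2)] by (auto simp: i(3) k(3) split: if_splits)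
  then show "\<exists>i\<in>I. obm v ` ob (seq_graph [C]) \<subseteq> tag i ` ob (F i)"
    using i k by (auto simp: ob_seq1)
qed (simp add: ob_seq1)

text \<open>The cotuple \<open>c\<close> keeps tags. A square from \<open>j\<close> to
  \<open>c\<close> has its bottom in one summand by connectedness of \<open>B\<close>, hence also
  its top, and is solved there. Conversely, a square for \<open>f i\<close> is pushed into the
  coproducts; the lift found there lies in a single summand, which must be \<open>i\<close>, and
  factors back because injections are monic.\<close>

lemma has_rlp_cotuple:
  assumes F: "\<And>i. i \<in> I \<Longrightarrow> f i \<in> Hom G (F i) (F' i)" "Cop G I F \<in> Obj G" "Cop G I F' \<in> Obj G"
    and j: "j \<in> Hom G S B" and B: "connected B"
  shows "has_rlp G (cotuple G I F (Cop G I F') (\<lambda>i. Inj G I F' i \<cdot>\<^bsub>G\<^esub> f i)) j \<longleftrightarrow> (\<forall>i\<in>I. has_rlp G (f i) j)"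
proof -
  let ?P = "Cop G I F" and ?P' = "Cop G I F'"
  let ?in = "Inj G I F" and ?in' = "Inj G I F'"
  define c where "c = cotuple G I F ?P' (\<lambda>i. ?in' i \<cdot>\<^bsub>G\<^esub> f i)"
  have FO: "F i \<in> Obj G" "F' i \<in> Obj G" if "i \<in> I" for i using G.Hom_Obj[OF F(1)[OF that]] by auto
  have inj: "?in i \<in> Hom G (F i) ?P" "?in' i \<in> Hom G (F' i) ?P'" if "i \<in> I" for i
    using that FO F(2,3) by (auto intro: G_Inj_Hom simp del: Graphs_simps)
  have "\<exists>!h. h \<in> Hom G ?P ?P' \<and> (\<forall>i\<in>I. h \<cdot>\<^bsub>G\<^esub> ?in i = ?in' i \<cdot>\<^bsub>G\<^esub> f i)"
    by (intro G_cotuple_ex1 G.Cmp_Hom[OF F(1) inj(2)] FO F(2,3))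
  from theI'[OF this] have c: "c \<in> Hom G ?P ?P'" and ci: "\<And>i. i \<in> I \<Longrightarrow> c \<cdot>\<^bsub>G\<^esub> ?in i = ?in' i \<cdot>\<^bsub>G\<^esub> f i"
    unfolding c_def cotuple_def by blast+
  have c_tag: "obm c (tag i x) = tag i (obm (f i) x)" if "i \<in> I" "x \<in> ob (F i)" for i x
  proof -
    have "obm (c \<cdot>\<^bsub>G\<^esub> ?in i) x = obm c (tag i x)"
      using G_Cmp_sel(1)[OF inj(1)[OF that(1)] that(2), of c] that by (simp add: G_Inj)
    moreover have "obm (?in' i \<cdot>\<^bsub>G\<^esub> f i) x = tag i (obm (f i) x)"
      using G_Inj_Cmp_sel(1)[where F = F' and I = I, OF F(1)[OF that(1)] that(2)] .
    ultimately show ?thesis using ci[OF that(1)] by simp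
  qed
  have c_in: "c \<cdot>\<^bsub>G\<^esub> (?in i \<cdot>\<^bsub>G\<^esub> u) = ?in' i \<cdot>\<^bsub>G\<^esub> (f i \<cdot>\<^bsub>G\<^esub> u)" if "i \<in> I" "u \<in> Hom G X (F i)" for i u X
    using G.Cmp_assoc[OF that(2) inj(1)[OF that(1)] c]
      G.Cmp_assoc[OF that(2) F(1)[OF that(1)] inj(2)[OF that(1)]] ci[OF that(1)] by simp
  have jd: "dm j = S" "cd j = B" and cd: "dm c = ?P" "cd c = ?P'" using j c by (auto simp: G.Hom_iff)
  have fd: "dm (f i) = F i" "cd (f i) = F' i" if "i \<in> I" for i using F(1)[OF that] by (auto simp: G.Hom_iff)
  have "has_rlp G c j \<longleftrightarrow> (\<forall>i\<in>I. has_rlp G (f i) j)"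
  proof (intro iffI ballI)
    fix i assume rlp: "has_rlp G c j" and i: "i \<in> I"
    note ini = inj[OF i]
    show "has_rlp G (f i) j"
      unfolding G.has_rlp_iff jd fd[OF i]
    proof (intro ballI impI)
      fix u v assume u: "u \<in> Hom G S (F i)" and v: "v \<in> Hom G B (F' i)" and sq: "f i \<cdot>\<^bsub>G\<^esub> u = v \<cdot>\<^bsub>G\<^esub> j"
      have "c \<cdot>\<^bsub>G\<^esub> (?in i \<cdot>\<^bsub>G\<^esub> u) = ?in' i \<cdot>\<^bsub>G\<^esub> v \<cdot>\<^bsub>G\<^esub> j"
        using c_in[OF i u] sq G.Cmp_assoc[OF j v ini(2)] by simp
      then obtain d where d: "d \<in> Hom G B ?P" "d \<cdot>\<^bsub>G\<^esub> j = ?in i \<cdot>\<^bsub>G\<^esub> u" "c \<cdot>\<^bsub>G\<^esub> d = ?in' i \<cdot>\<^bsub>G\<^esub> v"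
        using rlp G.Cmp_Hom[OF u ini(1)] G.Cmp_Hom[OF v ini(2)]
        unfolding G.has_rlp_iff jd cd by blast
      obtain k where k: "k \<in> I" "obm d ` ob B \<subseteq> tag k ` ob (F k)"
        using B d(1) FO(1) unfolding connected_def by blast
      \<comment> \<open>One object of \<open>B\<close> identifies the summand of the lift: its image
        under \<open>c\<close> is that of \<open>v\<close>, which carries the tag
        \<open>i\<close>.\<close>
      obtain b where b: "b \<in> ob B" using B by (auto simp: connected_def)
      have "obm (c \<cdot>\<^bsub>G\<^esub> d) b = tag i (obm v b)"
        using G_Inj_Cmp_sel(1)[where F = F' and I = I, OF v b] d(3) by simp
      moreover have "obm (c \<cdot>\<^bsub>G\<^esub> d) b = obm c (obm d b)" by (rule G_Cmp_sel(1)[OF d(1) b])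
      moreover obtain y where "obm d b = tag k y" "y \<in> ob (F k)" using b k by auto
      ultimately have "k = i" using c_tag[OF k(1)] by auto
      then obtain d' where d': "d' \<in> Hom G B (F i)" "?in i \<cdot>\<^bsub>G\<^esub> d' = d"
        using G_Inj_factor[where F = F, OF i FO(1)[OF i] d(1)] k by blast
      show "\<exists>d\<in>Hom G B (F i). d \<cdot>\<^bsub>G\<^esub> j = u \<and> f i \<cdot>\<^bsub>G\<^esub> d = v"
      proof (intro bexI[OF _ d'(1)] conjI)
        show "d' \<cdot>\<^bsub>G\<^esub> j = u"
          by (rule G_Inj_mono[where F = F and I = I, OF G.Cmp_Hom[OF j d'(1)] u])
            (use G.Cmp_assoc[OF j d'(1) ini(1)] d d' in simp)
        show "f i \<cdot>\<^bsub>G\<^esub> d' = v"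
          by (rule G_Inj_mono[where F = F' and I = I, OF G.Cmp_Hom[OF d'(1) F(1)[OF i]] v])
            (use c_in[OF i d'(1)] d d' in simp)
      qed
    qed
  next
    assume rlp: "\<forall>i\<in>I. has_rlp G (f i) j"
    show "has_rlp G c j"
      unfolding G.has_rlp_iff jd cd
    proof (intro ballI impI)
      fix u v assume u: "u \<in> Hom G S ?P" and v: "v \<in> Hom G B ?P'" and sq: "c \<cdot>\<^bsub>G\<^esub> u = v \<cdot>\<^bsub>G\<^esub> j"
      obtain i where i: "i \<in> I" "obm v ` ob B \<subseteq> tag i ` ob (F' i)"
        using B v FO(2) unfolding connected_def by blast
      note ini = inj[OF i(1)]
      obtain v' where v': "v' \<in> Hom G B (F' i)" "?in' i \<cdot>\<^bsub>G\<^esub> v' = v"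
        using G_Inj_factor[where F = F', OF i(1) FO(2)[OF i(1)] v] i by blast
      \<comment> \<open>Since \<open>c\<close> keeps tags, an object lying over summand
        \<open>i\<close> of the codomain comes from summand \<open>i\<close> of the domain.\<close>
      have "obm u x \<in> tag i ` ob (F i)" if x: "x \<in> ob S" for x
      proof -
        obtain k y where k: "k \<in> I" "y \<in> ob (F k)" "obm u x = tag k y"
          using Hom_GraphsD(5)[OF u x] by (auto simp: G_Cop_sel(1))
        have "tag k (obm (f k) y) = obm v (obm j x)"
          using arg_cong[OF sq, of "\<lambda>f. obm f x"] k c_tag[OF k(1,2)]
          by (simp add: G_Cmp_sel(1)[OF u x] G_Cmp_sel(1)[OF j x])
        moreover have "obm v (obm j x) \<in> tag i ` ob (F' i)" using i(2) Hom_GraphsD(5)[OF j x] by blast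
        ultimately show ?thesis using k by auto
      qed
      then obtain u' where u': "u' \<in> Hom G S (F i)" "?in i \<cdot>\<^bsub>G\<^esub> u' = u"
        using G_Inj_factor[where F = F, OF i(1) FO(1)[OF i(1)] u] by blast
      have "f i \<cdot>\<^bsub>G\<^esub> u' = v' \<cdot>\<^bsub>G\<^esub> j"
        by (rule G_Inj_mono[where F = F' and I = I, OF G.Cmp_Hom[OF u'(1) F(1)[OF i(1)]] G.Cmp_Hom[OF j v'(1)]])
          (use c_in[OF i(1) u'(1)] G.Cmp_assoc[OF j v'(1) ini(2)] u' v' sq in simp)
      then obtain d where d: "d \<in> Hom G B (F i)" "d \<cdot>\<^bsub>G\<^esub> j = u'" "f i \<cdot>\<^bsub>G\<^esub> d = v'"
        using rlp i(1) u' v' fd[OF i(1)] unfolding G.has_rlp_iff jd by metis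
      show "\<exists>d\<in>Hom G B ?P. d \<cdot>\<^bsub>G\<^esub> j = u \<and> c \<cdot>\<^bsub>G\<^esub> d = v"
      proof (intro bexI[OF _ G.Cmp_Hom[OF d(1) ini(1)]] conjI)
        show "?in i \<cdot>\<^bsub>G\<^esub> d \<cdot>\<^bsub>G\<^esub> j = u" using G.Cmp_assoc[OF j d(1) ini(1)] d u' by simp
        show "c \<cdot>\<^bsub>G\<^esub> (?in i \<cdot>\<^bsub>G\<^esub> d) = v" using c_in[OF i(1) d(1)] d v' by simp
      qed
    qed
  qed
  then show ?thesis by (simp only: c_def)
qed

end

section \<open>Contractibility\<close>

text \<open>Agreement is asked only at indices in \<open>I\<close>: \<open>summand\<close> recovers
  the ends of a path as \<open>hd p\<close> and \<open>last p\<close>, which are \<open>a\<close>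
  and \<open>b\<close> just for paths from \<open>a\<close> to \<open>b\<close>.\<close>

lemma cotuple_cong:
  assumes "Hom C = Hom D" "Cmp C = Cmp D" "Cop C I F = Cop D I F"
    and "\<And>i. i \<in> I \<Longrightarrow> Inj C I F i = Inj D I F i" "\<And>i. i \<in> I \<Longrightarrow> g i = h i"
  shows "cotuple C I F Z g = cotuple D I F Z h"
proof -
  have "(\<forall>i\<in>I. k \<cdot>\<^bsub>D\<^esub> Inj C I F i = g i) \<longleftrightarrow> (\<forall>i\<in>I. k \<cdot>\<^bsub>D\<^esub> Inj D I F i = h i)" for k
    using assms(4,5) by simp
  then show ?thesis unfolding cotuple_def assms(1-3) by simp
qed

lemma has_rlp_Sets: "has_rlp (Sets U) f j = has_rlp (Graphs U point_cat) f j"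
  by (simp only: has_rlp_def Hom_Sets Sets_Graphs)

text \<open>Since \<open>\<infinity> + 1 = \<infinity>\<close>, infinity falls under the successor
  case and is covered by the results on graphs.\<close>

lemma enat_0_or_Suc: "(n :: enat) = 0 \<or> (\<exists>m. n = m + 1)"
proof (cases n)
  case (enat k)
  then show ?thesis by (cases k) (auto simp: zero_enat_def one_enat_def intro!: exI[of _ "enat _"])
qed (auto intro: exI[of _ \<infinity>])

lemma Glob_0: "Glob U 0 = Sets U" and gen_0: "gen 0 = {empty_to_point, fold_points}"
  by (simp_all add: Glob_def gen_def zero_enat_def)

lemma graphs_Glob: "universe U \<Longrightarrow> graphs (Glob U n) U"
  using universe_finite[of U "{}"] by (simp add: graphs_def graphs_axioms_def gcategory_Glob)

lemma graphs_point_cat: "universe U \<Longrightarrow> graphs point_cat U"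
  by (simp add: graphs_def graphs_axioms_def point_cat.gcategory_axioms)

lemma (in graphs) fold_points_Hom: "fold_points \<in> Hom G two_points one_point"
  unfolding fold_points_def
  by (rule Hom_GraphsI[OF _ one_point_Obj])
    (use void_Obj void_map_Hom U_finite in \<open>auto simp: two_points_def one_point_def\<close>)

section \<open>The generating maps\<close>

lemma gen_Arr:
  assumes U: "universe (U :: 'u set \<Rightarrow> bool)" and j: "j \<in> gen n"
  shows "j \<in> Arr (Glob U n)"
proof -
  have plus: "j \<in> Arr (Glob U (m + 1))" if "j = empty_to_point \<or> (\<exists>i. j = seq_map i \<and> i \<in> Arr (Glob U m))"
    for m and j :: "'u gmap"
  proof -
    interpret graphs "Glob U m" U by (rule graphs_Glob[OF U])
    show ?thesis
      using that empty_to_point_Hom seq_map_Hom[OF Hom_self] by (auto simp: Glob_Suc G.Hom_iff)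
  qed
  have fin: "j \<in> gen (enat k) \<Longrightarrow> j \<in> Arr (Glob U (enat k))" for k and j :: "'u gmap"
  proof (induction k arbitrary: j)
    case 0
    interpret graphs point_cat U by (rule graphs_point_cat[OF U])
    show ?case using 0 empty_to_point_Hom fold_points_Hom
      by (auto simp: gen_def Glob_def Sets_Graphs G.Hom_iff)
  next
    case (Suc k)
    have k: "enat (Suc k) = enat k + 1" by (simp add: one_enat_def)
    have "j = empty_to_point \<or> (\<exists>i. j = seq_map i \<and> i \<in> gen (enat k))"
      using Suc.prems unfolding k gen_Suc plus_class_def by blast
    then show ?case unfolding k using Suc.IH by (intro plus) blast
  qed
  \<comment> \<open>The induction is on the dimension of the globe; the category stays the same
    because \<open>\<infinity> + 1 = \<infinity>\<close>.\<close>
  have "boundary_inclusion k \<in> Arr (Glob U \<infinity>)" for k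
    by (induction k) (use plus[where m = \<infinity>] in auto)
  then show ?thesis using fin j by (cases n) (auto simp: gen_def)
qed

text \<open>With \<open>Glob_no_Hom_void\<close> this excludes maps from the codomain of a generator
  to \<open>void\<close>, which makes the codomain of its \<open>seq_map\<close> connected one
  dimension higher.\<close>

lemma ob_cd_gen:
  assumes U: "universe (U :: 'u set \<Rightarrow> bool)" and j: "(j :: 'u gmap) \<in> gen n"
  shows "ob (cd j) \<noteq> {}"
proof -
  interpret graphs point_cat U by (rule graphs_point_cat[OF U])
  have "j = empty_to_point \<or> j = fold_points \<or> (\<exists>i. j = seq_map i)"
    using j enat_0_or_Suc[of n] by (auto simp: gen_0 gen_Suc plus_class_def)
  then show ?thesis
    by (auto simp: empty_to_point_def fold_points_def one_point_def seq_map_sel ob_seq1)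
qed

lemma Glob_no_Hom_void:
  assumes U: "universe U" and X: "ob X \<noteq> {}"
  shows "f \<notin> Hom (Glob U n) X void"
proof (cases "n = 0")
  case True
  interpret graphs point_cat U by (rule graphs_point_cat[OF U])
  show ?thesis using Hom_to_void X True by (auto simp: Glob_0 Hom_Sets)
next
  case False
  then obtain m where n: "n = m + 1" using enat_0_or_Suc by blast
  interpret graphs "Glob U m" U by (rule graphs_Glob[OF U])
  show ?thesis using Hom_to_void X by (auto simp: n Glob_Suc)
qed

section \<open>Lifting and coproducts in all dimensions\<close>

text \<open>\<open>Sets\<close> gives its coproducts \<open>void\<close> homs outright, while
  \<open>Graphs\<close> copies the homs of the summands; these are \<open>void\<close> as soon as
  the summands are sets.\<close>

lemma Cop_Inj_Sets:
  assumes U: "universe (U :: 'u set \<Rightarrow> bool)" and F: "\<And>i. i \<in> I \<Longrightarrow> F i \<in> Obj (Sets U)"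
  shows "Cop (Sets U) I F = Cop (Graphs U point_cat) I F"
    and "i \<in> I \<Longrightarrow> Inj (Sets U) I F i = Inj (Graphs U point_cat) I F i"
proof -
  interpret graphs point_cat U by (rule graphs_point_cat[OF U])
  show C: "Cop (Sets U) I F = Cop G I F"
  proof (rule gset_eqI)
    show "ob (Cop (Sets U) I F) = ob (Cop G I F)"
      by (simp add: Sets_def Graphs_def Let_def mk_graph_def)
    have "hm (Cop G I F) c d = void" for c d
      using F by (auto simp: Graphs_def Let_def mk_graph_def tagged_def)
    then show "hm (Cop (Sets U) I F) c d = hm (Cop G I F) c d" for c d
      by (simp add: Sets_def Let_def)
  qed
  show "Inj (Sets U) I F i = Inj G I F i" if "i \<in> I"
    unfolding G_Inj C[symmetric] by (rule gmap_eqI) (simp_all add: Sets_def Let_def)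
qed

text \<open>All codomains of generators are connected: each is \<open>one_point\<close> or
  \<open>(B)\<close> for the nonempty codomain \<open>B\<close> of a generator one dimension lower.
  For \<open>n = 0\<close> the coproducts are first exchanged for those of graphs over
  \<open>point_cat\<close>.\<close>

lemma Glob_has_rlp_cotuple:
  assumes U: "universe (U :: 'u set \<Rightarrow> bool)" and j: "j \<in> gen n"
    and f: "\<And>i. i \<in> I \<Longrightarrow> f i \<in> Hom (Glob U n) (F i) (F' i)"
    and F: "Cop (Glob U n) I F \<in> Obj (Glob U n)" "Cop (Glob U n) I F' \<in> Obj (Glob U n)"
  shows "has_rlp (Glob U n) (cotuple (Glob U n) I F (Cop (Glob U n) I F')
      (\<lambda>i. Inj (Glob U n) I F' i \<cdot>\<^bsub>Glob U n\<^esub> f i)) j \<longleftrightarrow> (\<forall>i\<in>I. has_rlp (Glob U n) (f i) j)"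
proof (cases "n = 0")
  case True
  interpret graphs point_cat U by (rule graphs_point_cat[OF U])
  have f': "f i \<in> Hom G (F i) (F' i)" if "i \<in> I" for i using f[OF that] by (simp add: True Glob_0 Hom_Sets)
  have FO: "F i \<in> Obj (Sets U)" "F' i \<in> Obj (Sets U)" if "i \<in> I" for i
    unfolding Sets_Graphs using G.Hom_Obj[OF f'[OF that]] by blast+
  note C = Cop_Inj_Sets[where F = F, OF U FO(1)] Cop_Inj_Sets[where F = F', OF U FO(2)]
  have "cotuple (Sets U) I F (Cop G I F') (\<lambda>i. Inj (Sets U) I F' i \<cdot>\<^bsub>G\<^esub> f i) =
      cotuple G I F (Cop G I F') (\<lambda>i. Inj G I F' i \<cdot>\<^bsub>G\<^esub> f i)"
    by (rule cotuple_cong) (simp_all add: Hom_Sets Sets_Graphs C)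
  moreover have "has_rlp G (cotuple G I F (Cop G I F') (\<lambda>i. Inj G I F' i \<cdot>\<^bsub>G\<^esub> f i)) j \<longleftrightarrow> (\<forall>i\<in>I. has_rlp G (f i) j)"
  proof (rule has_rlp_cotuple[OF f'])
    show "Cop G I F \<in> Obj G" "Cop G I F' \<in> Obj G" using F C(1,3) by (simp_all only: True Glob_0 Sets_Graphs(1))
    show "j \<in> Hom G (dm j) (cd j)"
      using gen_Arr[OF U j] by (simp add: True Glob_0 Sets_Graphs G.Hom_iff)
    have "cd j = one_point" using j by (auto simp: True gen_0 empty_to_point_def fold_points_def)
    then show "connected (cd j)" using connected_one_point by simp
  qed
  ultimately show ?thesis
    by (simp add: True Glob_0 has_rlp_Sets Sets_Graphs C(3))
next
  case False
  then obtain m where n: "n = m + 1" using enat_0_or_Suc by blast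
  interpret graphs "Glob U m" U by (rule graphs_Glob[OF U])
  note G = Glob_Suc[of U m, folded n]
  show ?thesis
    unfolding G
  proof (rule has_rlp_cotuple)
    show "f i \<in> Hom G (F i) (F' i)" if "i \<in> I" for i using f[OF that] unfolding G .
    show "Cop G I F \<in> Obj G" "Cop G I F' \<in> Obj G" using F unfolding G by blast+
    show "j \<in> Hom G (dm j) (cd j)" using gen_Arr[OF U j] unfolding G by (rule G.Hom_self)
    have "j = empty_to_point \<or> (\<exists>i\<in>gen m. j = seq_map i)"
      using j by (auto simp: n gen_Suc plus_class_def)
    then show "connected (cd j)"
    proof
      assume "j = empty_to_point"
      then show ?thesis using connected_one_point by (simp add: empty_to_point_def)
    next
      assume "\<exists>i\<in>gen m. j = seq_map i"
      then obtain i where i: "i \<in> gen m" "j = seq_map i" by blast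
      then show ?thesis
        using connected_seq_graph[of "cd i"] Glob_no_Hom_void[OF U ob_cd_gen[OF U i(1)]] by (simp add: seq_map_sel)
    qed
  qed
qed

section \<open>Homs along paths\<close>

lemma (in graphs) homs_Obj:
  assumes "X \<in> Obj G" "p \<in> paths X a b"
  shows "homs X p \<in> lists (Obj V)"
proof -
  have "hm X x y \<in> Obj V" if "(x, y) \<in> set (steps p)" for x y
  proof -
    have "x \<in> set p" "y \<in> set p"
      using set_zip_leftD[OF that[unfolded steps_def]] set_zip_rightD[OF that[unfolded steps_def]]
      by (cases p; auto)+
    then have "x \<in> ob X" "y \<in> ob X" using assms(2) by (auto simp: paths_def)
    then show ?thesis by (rule Obj_Graphs_hm[OF assms(1)])
  qed
  then show ?thesis by (auto simp: homs_def)
qed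

text \<open>Realises any sequence as the homs along one path. The empty sequence belongs to the path
  \<open>[num 0]\<close> without steps, so that nullary components are reached too.\<close>

lemma (in graphs) homs_seq_graph:
  fixes Xs :: "'u gset list"
  defines "p \<equiv> map num [0..<Suc (length Xs)]"
  shows "p \<in> paths (seq_graph Xs) (num 0) (num (length Xs))" "homs (seq_graph Xs) p = Xs"
proof -
  show "p \<in> paths (seq_graph Xs) (num 0) (num (length Xs))"
    by (auto simp: p_def paths_def seq_graph_sel(1) hd_map last_map simp del: upt_Suc)
  have len: "length (steps p) = length Xs" by (simp add: steps_def p_def)
  show "homs (seq_graph Xs) p = Xs"
  proof (rule nth_equalityI)
    show "homs (seq_graph Xs) p ! i = Xs ! i" if "i < length (homs (seq_graph Xs) p)" for i
    proof -
      have i: "i < length Xs" using that len by (simp add: homs_def)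
      then have "steps p ! i = (num i, num (Suc i))"
        by (simp add: steps_def p_def nth_tl del: upt_Suc)
      then show ?thesis using i len by (simp add: homs_def seq_graph_sel(2))
    qed
  qed (simp add: homs_def len)
qed

section \<open>Comparison of the two notions of contractibility\<close>

lemma Fo_Gamma: "Fo (Gamma V E) = Gamma_obj V E"
  by (simp add: Gamma_def Let_def)

theorem corollary6p3p2:
  fixes U :: "'u set \<Rightarrow> bool" and n :: enat
    and A :: "'u gmonad" and \<alpha> :: "'u gset \<Rightarrow> 'u gmap"
    and E :: "'u gtensor" and \<epsilon> :: "'u gset list \<Rightarrow> 'u gmap"
  assumes "universe U"
    and "is_operad_over_Set U (n + 1) A \<alpha>"
    and "is_strict_multitensor U n E \<epsilon>"
    and "corresponds U n E \<epsilon> A \<alpha>"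
  shows "contractible_operad U (n + 1) \<alpha> \<longleftrightarrow> contractible_multitensor U n \<epsilon>"
proof -
  let ?V = "Glob U n" and ?F = "strict_cross U n"
  interpret graphs ?V U by (rule graphs_Glob[OF assms(1)])
  have \<epsilon>: "\<epsilon> Xs \<in> Hom ?V (Mo E Xs) (Mo ?F Xs)" if "Xs \<in> lists (Obj ?V)" for Xs
    using assms(3) that unfolding is_strict_multitensor_def is_multitensor_map_def by blast
  \<comment> \<open>By \<open>strict_Suc\<close> the codomain of \<open>\<alpha> X\<close> is
    literally the graph into which \<open>Gamma_map\<close> goes, also for
    \<open>n = \<infinity>\<close>.\<close>
  have \<alpha>: "\<alpha> X \<in> Hom G (Fo A X) (Gamma_obj ?V ?F X)" if "X \<in> Obj G" for X
    using assms(2) that unfolding is_operad_over_Set_def is_monad_map_def Glob_Suc strict_Suc Fo_Gamma by blast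
  obtain \<phi> where m: "is_monad_map G (Gamma ?V E) A \<phi>"
    and \<phi>: "\<And>X. X \<in> Obj G \<Longrightarrow> is_iso G (\<phi> X)"
      "\<And>X. X \<in> Obj G \<Longrightarrow> \<alpha> X \<cdot>\<^bsub>G\<^esub> \<phi> X = Gamma_map ?V E ?F \<epsilon> X"
    using assms(4) unfolding corresponds_def Glob_Suc by blast
  have \<phi>_Hom: "\<phi> X \<in> Hom G (Gamma_obj ?V E X) (Fo A X)" if "X \<in> Obj G" for X
    using m that unfolding is_monad_map_def Fo_Gamma by blast
  let ?\<Gamma> = "Gamma_map ?V E ?F \<epsilon>"
  \<comment> \<open>The typing comes from the composite of \<open>\<phi> X\<close> and
    \<open>\<alpha> X\<close>. It also shows that both graphs are objects of \<open>G\<close>, hence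
    that the coproducts forming their homs are objects of \<open>?V\<close>.\<close>
  have \<Gamma>: "?\<Gamma> X \<in> Hom G (Gamma_obj ?V E X) (Gamma_obj ?V ?F X)" if "X \<in> Obj G" for X
    using G.Cmp_Hom[OF \<phi>_Hom[OF that] \<alpha>[OF that]] \<phi>(2)[OF that] by simp
  have \<Gamma>_id: "identity_on_objects (?\<Gamma> X)" for X
    by (simp add: identity_on_objects_def Gamma_map_def Gamma_obj_sel)
  have \<Gamma>_rlp: "has_rlp ?V (hmm (?\<Gamma> X) a b) j \<longleftrightarrow> (\<forall>p\<in>paths X a b. has_rlp ?V (\<epsilon> (homs X p)) j)"
    if X: "X \<in> Obj G" and ab: "a \<in> ob X" "b \<in> ob X" and j: "j \<in> gen n" for X a b j
  proof -
    let ?c = "cotuple ?V (paths X a b) (\<lambda>p. Mo E (homs X p)) (Cop ?V (paths X a b) (\<lambda>p. Mo ?F (homs X p)))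
      (\<lambda>p. Inj ?V (paths X a b) (\<lambda>p. Mo ?F (homs X p)) p \<cdot>\<^bsub>?V\<^esub> \<epsilon> (homs X p))"
    have "hmm (?\<Gamma> X) a b = from_sum ?V E X a b (Cop ?V (paths X a b) (\<lambda>p. Mo ?F (homs X p)))
        (\<lambda>p. summand ?V ?F X p \<cdot>\<^bsub>?V\<^esub> \<epsilon> (homs X p))"
      using ab by (simp add: Gamma_map_def Gamma_obj_sel)
    also have "\<dots> = ?c"
      unfolding from_sum_def by (rule cotuple_cong) (simp_all add: summand_def paths_def)
    finally have c: "hmm (?\<Gamma> X) a b = ?c" .
    have "Cop ?V (paths X a b) (\<lambda>p. Mo E (homs X p)) \<in> Obj ?V"
      "Cop ?V (paths X a b) (\<lambda>p. Mo ?F (homs X p)) \<in> Obj ?V"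
      using Obj_Graphs_hm[of "Gamma_obj ?V E X" U ?V a b] Obj_Graphs_hm[of "Gamma_obj ?V ?F X" U ?V a b]
        G.Hom_Obj[OF \<Gamma>[OF X]] ab by (simp_all add: Gamma_obj_sel del: Graphs_simps)
    then show ?thesis
      unfolding c by (intro Glob_has_rlp_cotuple[OF assms(1) j] \<epsilon> homs_Obj[OF X])
  qed
  have "contractible_operad U (n + 1) \<alpha> \<longleftrightarrow>
      (\<forall>X\<in>Obj G. \<forall>j\<in>plus_class (gen n). has_rlp G (\<alpha> X) j)"
    unfolding contractible_operad_def trivial_fibration_def Glob_Suc gen_Suc
    using \<alpha> by (auto simp: G.Hom_iff simp del: Graphs_simps)
  \<comment> \<open>Precomposition with the isomorphism \<open>\<phi> X\<close> replaces
    \<open>\<alpha> X\<close> by \<open>?\<Gamma> X\<close>, which is the identity on objects by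
    construction.\<close>
  also have "\<dots> \<longleftrightarrow> (\<forall>X\<in>Obj G. \<forall>j\<in>plus_class (gen n). has_rlp G (?\<Gamma> X) j)"
  proof (intro ball_cong refl)
    fix X and j :: "'u gmap" assume X: "X \<in> Obj G" and "j \<in> plus_class (gen n)"
    then have "j \<in> Arr G" using gen_Arr[OF assms(1), of j "n + 1"] by (simp add: gen_Suc Glob_Suc)
    from G.has_rlp_iso[OF \<alpha>[OF X] \<phi>_Hom[OF X] \<phi>(1)[OF X] this] show "has_rlp G (\<alpha> X) j = has_rlp G (?\<Gamma> X) j"
      by (simp add: \<phi>(2)[OF X])
  qed
  also have "\<dots> \<longleftrightarrow> (\<forall>X\<in>Obj G. \<forall>a\<in>ob X. \<forall>b\<in>ob X. \<forall>j\<in>gen n. has_rlp ?V (hmm (?\<Gamma> X) a b) j)"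
  proof (intro ball_cong refl)
    fix X assume X: "X \<in> Obj G"
    have "has_rlp G (?\<Gamma> X) (seq_map j) \<longleftrightarrow> (\<forall>a\<in>ob X. \<forall>b\<in>ob X. has_rlp ?V (hmm (?\<Gamma> X) a b) j)"
      if "j \<in> gen n" for j
      using has_rlp_seq_map[OF \<Gamma>[OF X] \<Gamma>_id gen_Arr[OF assms(1) that]] by (simp add: Gamma_obj_sel)
    then show "(\<forall>j\<in>plus_class (gen n). has_rlp G (?\<Gamma> X) j) \<longleftrightarrow>
        (\<forall>a\<in>ob X. \<forall>b\<in>ob X. \<forall>j\<in>gen n. has_rlp ?V (hmm (?\<Gamma> X) a b) j)"
      using has_rlp_empty_to_point[OF \<Gamma>[OF X] \<Gamma>_id] by (auto simp: plus_class_def)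
  qed
  also have "\<dots> \<longleftrightarrow> (\<forall>X\<in>Obj G. \<forall>a\<in>ob X. \<forall>b\<in>ob X. \<forall>j\<in>gen n. \<forall>p\<in>paths X a b. has_rlp ?V (\<epsilon> (homs X p)) j)"
    using \<Gamma>_rlp by (intro ball_cong refl)
  also have "\<dots> \<longleftrightarrow> (\<forall>Xs\<in>lists (Obj ?V). \<forall>j\<in>gen n. has_rlp ?V (\<epsilon> Xs) j)"
  proof (intro iffI ballI)
    fix X a b p and j :: "'u gmap"
    assume "\<forall>Xs\<in>lists (Obj ?V). \<forall>j\<in>gen n. has_rlp ?V (\<epsilon> Xs) j" "X \<in> Obj G" "j \<in> gen n" "p \<in> paths X a b"
    then show "has_rlp ?V (\<epsilon> (homs X p)) j" using homs_Obj by blast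
  next
    fix Xs and j :: "'u gmap"
    assume H: "\<forall>X\<in>Obj G. \<forall>a\<in>ob X. \<forall>b\<in>ob X. \<forall>j\<in>gen n. \<forall>p\<in>paths X a b. has_rlp ?V (\<epsilon> (homs X p)) j"
      and Xs: "Xs \<in> lists (Obj ?V)" and j: "j \<in> gen n"
    have "seq_graph Xs \<in> Obj G" using Xs by (intro seq_graph_Obj) auto
    moreover have "num 0 \<in> ob (seq_graph Xs)" "num (length Xs) \<in> ob (seq_graph Xs)"
      by (auto simp: seq_graph_sel(1))
    ultimately have "has_rlp ?V (\<epsilon> (homs (seq_graph Xs) (map num [0..<Suc (length Xs)]))) j"
      using H j homs_seq_graph(1)[of Xs] by blast
    then show "has_rlp ?V (\<epsilon> Xs) j" by (simp only: homs_seq_graph(2))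
  qed
  also have "\<dots> \<longleftrightarrow> contractible_multitensor U n \<epsilon>"
    unfolding contractible_multitensor_def trivial_fibration_def using \<epsilon> by (auto simp: Hom_iff)
  finally show ?thesis .
qed

end
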